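(* The system $\mathrm{S4}\mu$ is sound and complete over the class of finite reflexive transitive Kripke frames (finite $\mathrm{S4}$ frames).
   Context: $\mathsf{Var}$ is an infinite set of propositional variables (atoms). $\mathcal L_\Box^\mu$-formulas: atoms; $\top$; $\neg\varphi$; $\varphi\wedge\psi$; $\Box\varphi$; and $\mu q\varphi$ where $q\in\mathsf{Var}$ and $\varphi$ is positive in $q$ (every free occurrence of $q$ in $\varphi$ lies under an even number of negations; $\mu q$ binds $q$). $\varphi(\psi/q)$ is the result of replacing each free occurrence of $q$ in $\varphi$ by $\psi$. Kripke semantics in a model $(W,R,h)$, $h:\mathsf{Var}\to\wp(W)$: atoms, $\top$, Booleans as usual; $\Box\varphi$ is true at $w$ iff $\varphi$ is true at all $v$ with $Rwv$; $\mu q\varphi$ is true at $w$ iff $w$ is in the least fixed point of the monotonic map $S\mapsto\{v\in W:(W,R,h[S/q]),v\models\varphi\}$ on $\wp(W)$, where $h[S/q]$ agrees with $h$ except that it sends $q$ to $S$. A formula is valid in a frame $(W,R)$ if it is true at every world under every $h$. $\mathrm{S4}\mu$ is the Hilbert system with axioms: all instances of propositional tautologies; $\Box(\varphi\to\psi)\to(\Box\varphi\to\Box\psi)$; $\Box\varphi\to\varphi$; $\Box\varphi\to\Box\Box\varphi$; and the fixed point axiom $\varphi(\mu q\varphi/q)\to\mu q\varphi$ (for $\varphi$ positive in $q$, provided no free occurrence of an atom in $\mu q\varphi$ gets bound in $\varphi(\mu q\varphi/q)$). Rules: modus ponens; from $\varphi$ infer $\Box\varphi$; and the fixed point rule: from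 $\varphi(\psi/q)\to\psi$ infer $\mu q\varphi\to\psi$ (for $\varphi$ positive in $q$, provided no free occurrence of an atom in $\psi$ gets bound in $\varphi(\psi/q)$). Sound over a class of frames: every theorem is valid in every frame of the class. Complete over the class: every $\mathcal L_\Box^\mu$-formula valid in every frame of the class is a theorem.
   Formalization: A formula counts as a theorem of S4μ if some renaming of its bound atoms is derivable; with literal theoremhood completeness fails, since ¬p → μq¬(p ∧ ¬μp q) is valid but, because of the capture proviso on the fixed point axiom, not derivable. *)

theory Defs
  imports Main
begin

section \<open>Formulas\<close>

text \<open>
  The parameter \<open>'v\<close> is the set of atoms. The datatype comprises raw terms; the formulas are
  singled out by \<open>is_fm\<close> below, which imposes the positivity condition on \<open>Mu\<close>.
\<close>

datatype 'v fm =
    Atom 'v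
  | Top
  | Neg "'v fm"
  | Conj "'v fm" "'v fm"
  | Box "'v fm"
  | Mu 'v "'v fm"

definition Imp :: "'v fm \<Rightarrow> 'v fm \<Rightarrow> 'v fm" (infixr "\<^bold>\<longrightarrow>" 55) where
  "\<phi> \<^bold>\<longrightarrow> \<psi> = Neg (Conj \<phi> (Neg \<psi>))"

primrec fv :: "'v fm \<Rightarrow> 'v set" where
  "fv (Atom p) = {p}"
| "fv Top = {}"
| "fv (Neg \<phi>) = fv \<phi>"
| "fv (Conj \<phi> \<psi>) = fv \<phi> \<union> fv \<psi>"
| "fv (Box \<phi>) = fv \<phi>"
| "fv (Mu p \<phi>) = fv \<phi> - {p}"

text \<open>
  \<open>occ_parity q True \<phi>\<close> (resp.\ \<open>occ_parity q False \<phi>\<close>): every free occurrence of \<open>q\<close> in \<open>\<phi>\<close> lies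
  under an even (resp.\ odd) number of negations.
\<close>

primrec occ_parity :: "'v \<Rightarrow> bool \<Rightarrow> 'v fm \<Rightarrow> bool" where
  "occ_parity q b (Atom p) \<longleftrightarrow> (p = q \<longrightarrow> b)"
| "occ_parity q b Top \<longleftrightarrow> True"
| "occ_parity q b (Neg \<phi>) \<longleftrightarrow> occ_parity q (\<not> b) \<phi>"
| "occ_parity q b (Conj \<phi> \<psi>) \<longleftrightarrow> occ_parity q b \<phi> \<and> occ_parity q b \<psi>"
| "occ_parity q b (Box \<phi>) \<longleftrightarrow> occ_parity q b \<phi>"
| "occ_parity q b (Mu p \<phi>) \<longleftrightarrow> p = q \<or> occ_parity q b \<phi>"

abbreviation positive :: "'v \<Rightarrow> 'v fm \<Rightarrow> bool" where
  "positive q \<phi> \<equiv> occ_parity q True \<phi>"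

primrec is_fm :: "'v fm \<Rightarrow> bool" where
  "is_fm (Atom p) \<longleftrightarrow> True"
| "is_fm Top \<longleftrightarrow> True"
| "is_fm (Neg \<phi>) \<longleftrightarrow> is_fm \<phi>"
| "is_fm (Conj \<phi> \<psi>) \<longleftrightarrow> is_fm \<phi> \<and> is_fm \<psi>"
| "is_fm (Box \<phi>) \<longleftrightarrow> is_fm \<phi>"
| "is_fm (Mu q \<phi>) \<longleftrightarrow> is_fm \<phi> \<and> positive q \<phi>"

text \<open>
  \<open>subst \<phi> \<psi> q\<close> is the literal (capture-permitting) replacement \<open>\<phi>(\<psi>/q)\<close>;
  \<open>free_for \<psi> q \<phi>\<close> says that no free occurrence of an atom in \<open>\<psi>\<close> gets bound in \<open>\<phi>(\<psi>/q)\<close>.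
\<close>

primrec subst :: "'v fm \<Rightarrow> 'v fm \<Rightarrow> 'v \<Rightarrow> 'v fm" where
  "subst (Atom p) \<psi> q = (if p = q then \<psi> else Atom p)"
| "subst Top \<psi> q = Top"
| "subst (Neg \<phi>) \<psi> q = Neg (subst \<phi> \<psi> q)"
| "subst (Conj \<phi> \<chi>) \<psi> q = Conj (subst \<phi> \<psi> q) (subst \<chi> \<psi> q)"
| "subst (Box \<phi>) \<psi> q = Box (subst \<phi> \<psi> q)"
| "subst (Mu p \<phi>) \<psi> q = (if p = q then Mu p \<phi> else Mu p (subst \<phi> \<psi> q))"

primrec free_for :: "'v fm \<Rightarrow> 'v \<Rightarrow> 'v fm \<Rightarrow> bool" where
  "free_for \<psi> q (Atom p) \<longleftrightarrow> True"
| "free_for \<psi> q Top \<longleftrightarrow> True"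
| "free_for \<psi> q (Neg \<phi>) \<longleftrightarrow> free_for \<psi> q \<phi>"
| "free_for \<psi> q (Conj \<phi> \<chi>) \<longleftrightarrow> free_for \<psi> q \<phi> \<and> free_for \<psi> q \<chi>"
| "free_for \<psi> q (Box \<phi>) \<longleftrightarrow> free_for \<psi> q \<phi>"
| "free_for \<psi> q (Mu p \<phi>) \<longleftrightarrow> p = q \<or> ((q \<in> fv \<phi> \<longrightarrow> p \<notin> fv \<psi>) \<and> free_for \<psi> q \<phi>)"

text \<open>Equality of formulas up to renaming of bound atoms.\<close>

inductive alpha_eq :: "'v fm \<Rightarrow> 'v fm \<Rightarrow> bool" (infix "=\<^sub>\<alpha>" 50) where
  rename: "p \<notin> fv \<phi> \<Longrightarrow> free_for (Atom p) q \<phi> \<Longrightarrow> Mu q \<phi> =\<^sub>\<alpha> Mu p (subst \<phi> (Atom p) q)"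
| refl: "\<phi> =\<^sub>\<alpha> \<phi>"
| sym: "\<phi> =\<^sub>\<alpha> \<psi> \<Longrightarrow> \<psi> =\<^sub>\<alpha> \<phi>"
| trans: "\<phi> =\<^sub>\<alpha> \<psi> \<Longrightarrow> \<psi> =\<^sub>\<alpha> \<chi> \<Longrightarrow> \<phi> =\<^sub>\<alpha> \<chi>"
| Neg: "\<phi> =\<^sub>\<alpha> \<phi>' \<Longrightarrow> Neg \<phi> =\<^sub>\<alpha> Neg \<phi>'"
| Conj: "\<phi> =\<^sub>\<alpha> \<phi>' \<Longrightarrow> \<psi> =\<^sub>\<alpha> \<psi>' \<Longrightarrow> Conj \<phi> \<psi> =\<^sub>\<alpha> Conj \<phi>' \<psi>'"
| Box: "\<phi> =\<^sub>\<alpha> \<phi>' \<Longrightarrow> Box \<phi> =\<^sub>\<alpha> Box \<phi>'"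
| Mu: "\<phi> =\<^sub>\<alpha> \<phi>' \<Longrightarrow> Mu q \<phi> =\<^sub>\<alpha> Mu q \<phi>'"


section \<open>Kripke semantics\<close>

type_synonym 'w frame = "'w set \<times> ('w \<times> 'w) set"

text \<open>
  In the clause for \<open>Mu\<close> the map sends every set into \<open>W\<close> and, as \<open>R \<subseteq> W \<times> W\<close> in a frame, ignores
  the part of its argument outside \<open>W\<close>. So its least fixed point among all sets of type \<open>'w set\<close>
  is its least fixed point in the powerset of \<open>W\<close>. (For a raw term that is not a formula the map
  need not be monotone; such terms are never considered.)
\<close>

primrec sat :: "'v fm \<Rightarrow> 'w set \<Rightarrow> ('w \<times> 'w) set \<Rightarrow> ('v \<Rightarrow> 'w set) \<Rightarrow> 'w \<Rightarrow> bool" where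
  "sat (Atom p) W R h w \<longleftrightarrow> w \<in> h p"
| "sat Top W R h w \<longleftrightarrow> True"
| "sat (Neg \<phi>) W R h w \<longleftrightarrow> \<not> sat \<phi> W R h w"
| "sat (Conj \<phi> \<psi>) W R h w \<longleftrightarrow> sat \<phi> W R h w \<and> sat \<psi> W R h w"
| "sat (Box \<phi>) W R h w \<longleftrightarrow> (\<forall>v. (w, v) \<in> R \<longrightarrow> sat \<phi> W R h v)"
| "sat (Mu q \<phi>) W R h w \<longleftrightarrow> w \<in> lfp (\<lambda>S. {v \<in> W. sat \<phi> W R (h(q := S)) v})"

definition valid_in :: "'w frame \<Rightarrow> 'v fm \<Rightarrow> bool" where
  "valid_in F \<phi> \<longleftrightarrow>
     (\<forall>h. (\<forall>q. h q \<subseteq> fst F) \<longrightarrow> (\<forall>w\<in>fst F. sat \<phi> (fst F) (snd F) h w))"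

text \<open>The empty frame is not excluded; every formula is trivially valid in it.\<close>

definition finite_S4_frames :: "'w frame set" where
  "finite_S4_frames = {(W, R). finite W \<and> R \<subseteq> W \<times> W \<and> refl_on W R \<and> trans R}"


section \<open>The Hilbert system\<close>

text \<open>
  Propositional schemata: \<open>inst \<sigma> t\<close> is the instance of \<open>t\<close> under the substitution \<open>\<sigma>\<close>, and \<open>t\<close> is
  a tautology if it evaluates to true under every truth assignment. Any formula has only finitely
  many subformulas, so letters indexed by \<^typ>\<open>nat\<close> suffice.
\<close>

datatype pf = PLetter nat | PTop | PNeg pf | PConj pf pf

primrec peval :: "(nat \<Rightarrow> bool) \<Rightarrow> pf \<Rightarrow> bool" where
  "peval a (PLetter n) \<longleftrightarrow> a n"
| "peval a PTop \<longleftrightarrow> True"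
| "peval a (PNeg t) \<longleftrightarrow> \<not> peval a t"
| "peval a (PConj t u) \<longleftrightarrow> peval a t \<and> peval a u"

primrec inst :: "(nat \<Rightarrow> 'v fm) \<Rightarrow> pf \<Rightarrow> 'v fm" where
  "inst \<sigma> (PLetter n) = \<sigma> n"
| "inst \<sigma> PTop = Top"
| "inst \<sigma> (PNeg t) = Neg (inst \<sigma> t)"
| "inst \<sigma> (PConj t u) = Conj (inst \<sigma> t) (inst \<sigma> u)"

definition tautology :: "pf \<Rightarrow> bool" where
  "tautology t \<longleftrightarrow> (\<forall>a. peval a t)"

inductive derivable :: "'v fm \<Rightarrow> bool" where
  Taut: "tautology t \<Longrightarrow> is_fm (inst \<sigma> t) \<Longrightarrow> derivable (inst \<sigma> t)"
| K: "is_fm \<phi> \<Longrightarrow> is_fm \<psi> \<Longrightarrow> derivable (Box (\<phi> \<^bold>\<longrightarrow> \<psi>) \<^bold>\<longrightarrow> (Box \<phi> \<^bold>\<longrightarrow> Box \<psi>))"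
| T: "is_fm \<phi> \<Longrightarrow> derivable (Box \<phi> \<^bold>\<longrightarrow> \<phi>)"
| Four: "is_fm \<phi> \<Longrightarrow> derivable (Box \<phi> \<^bold>\<longrightarrow> Box (Box \<phi>))"
| Fix: "is_fm \<phi> \<Longrightarrow> positive q \<phi> \<Longrightarrow> free_for (Mu q \<phi>) q \<phi> \<Longrightarrow>
    derivable (subst \<phi> (Mu q \<phi>) q \<^bold>\<longrightarrow> Mu q \<phi>)"
| MP: "derivable \<phi> \<Longrightarrow> derivable (\<phi> \<^bold>\<longrightarrow> \<psi>) \<Longrightarrow> derivable \<psi>"
| Nec: "derivable \<phi> \<Longrightarrow> derivable (Box \<phi>)"
| Ind: "is_fm \<phi> \<Longrightarrow> positive q \<phi> \<Longrightarrow> is_fm \<psi> \<Longrightarrow> free_for \<psi> q \<phi> \<Longrightarrow>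
    derivable (subst \<phi> \<psi> q \<^bold>\<longrightarrow> \<psi>) \<Longrightarrow> derivable (Mu q \<phi> \<^bold>\<longrightarrow> \<psi>)"

text \<open>
  As usual, formulas are identified up to renaming of bound atoms, so that \<open>\<phi>\<close> is a theorem if some
  bound-renaming variant of it is derivable. Without this convention completeness fails because of
  the provisos of \<open>Fix\<close> and \<open>Ind\<close>: for distinct \<open>p\<close>, \<open>q\<close> the formula
  \<open>Neg (Atom p) \<^bold>\<longrightarrow> Mu q (Neg (Conj (Atom p) (Neg (Mu p (Atom q)))))\<close>, in which \<open>p\<close> occurs both
  free and bound, is valid in all frames, but it is not \<open>derivable\<close>.
\<close>

definition S4mu :: "'v fm \<Rightarrow> bool" where
  "S4mu \<phi> \<longleftrightarrow> (\<exists>\<phi>'. \<phi> =\<^sub>\<alpha> \<phi>' \<and> derivable \<phi>')"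


section \<open>Soundness and completeness\<close>

text \<open>
  A class of frames is a set of frames with worlds in a type \<open>'w\<close>. Up to isomorphism, the finite
  frames with worlds in \<open>'w\<close> are all finite frames as soon as \<open>'w\<close> is infinite.
\<close>

definition sound_over :: "('v fm \<Rightarrow> bool) \<Rightarrow> 'w frame set \<Rightarrow> bool" where
  "sound_over L C \<longleftrightarrow> (\<forall>\<phi>. L \<phi> \<longrightarrow> (\<forall>F\<in>C. valid_in F \<phi>))"

definition complete_over :: "('v fm \<Rightarrow> bool) \<Rightarrow> 'w frame set \<Rightarrow> bool" where
  "complete_over L C \<longleftrightarrow> (\<forall>\<phi>. is_fm \<phi> \<longrightarrow> (\<forall>F\<in>C. valid_in F \<phi>) \<longrightarrow> L \<phi>)"

end

theory Submission
  imports Defs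
begin

text \<open>
  Completeness does not go through Walukiewicz's theorem. Fix a formula \<open>\<phi>\<close>, a finite closure \<open>\<Sigma>\<close>
  of its subformulas in which fixed point variables are replaced by the fixed points they stand
  for, and call \<open>x \<inter> \<Sigma>\<close> the type of a maximal consistent set \<open>x\<close>. By induction on the number of
  types seen from \<open>x\<close>, there is a finite S4 model realizing exactly these types: pass to a final
  set \<open>y\<close> above \<open>x\<close> that sees the same types, and put the cluster of types occurring there
  cofinally below the models, given by induction, of the sets above \<open>y\<close> that see fewer types. In
  the truth lemma, truth outside the cluster is known, and inside it the approximants of a least
  fixed point are unions of types, hence definable; so the least fixed point in the model can be
  compared with the formula \<open>Mu\<close> by means of \<open>Fix\<close> and \<open>Ind\<close>.
\<close>

section \<open>Simultaneous substitution\<close>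

text \<open>The obstacle: a least fixed point is minimal among all sets of worlds, while
  \<open>Ind\<close> compares \<open>Mu\<close> with formulas only. For a cluster the gap closes,
  since its worlds are types over a finite set. An approximant must also have a value outside the
  cluster; there it is kept equal to the actual fixed point, which is harmless because worlds
  outside never see the cluster. A second obstacle is that facts about approximants hold only above
  \<open>y\<close>, whereas \<open>Ind\<close> asks for a derivable premise. So finitely many such
  facts are packed into a formula \<open>\<gamma>\<close> saying that they hold at everything above,
  and \<open>\<gamma>\<close> becomes the antecedent of the invariant given to \<open>Ind\<close>.
  Transitivity makes \<open>\<gamma>\<close> imply \<open>Box \<gamma>\<close>, which is what
  monotonicity under \<open>Box\<close> requires; it also makes the set of seen types shrink along
  \<open>acc\<close>, on which the induction rests. Finally, the provisos of \<open>Fix\<close> and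
  \<open>Ind\<close> are met by fixing a set \<open>A\<close> that contains all free atoms in play
  and no bound ones.\<close>

primrec ssubst :: "('v \<Rightarrow> 'v fm) \<Rightarrow> 'v fm \<Rightarrow> 'v fm" where
  "ssubst \<sigma> (Atom p) = \<sigma> p"
| "ssubst \<sigma> Top = Top"
| "ssubst \<sigma> (Neg \<phi>) = Neg (ssubst \<sigma> \<phi>)"
| "ssubst \<sigma> (Conj \<phi> \<psi>) = Conj (ssubst \<sigma> \<phi>) (ssubst \<sigma> \<psi>)"
| "ssubst \<sigma> (Box \<phi>) = Box (ssubst \<sigma> \<phi>)"
| "ssubst \<sigma> (Mu p \<phi>) = Mu p (ssubst (\<sigma>(p := Atom p)) \<phi>)"

primrec bv :: "'v fm \<Rightarrow> 'v set" where
  "bv (Atom p) = {}"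
| "bv Top = {}"
| "bv (Neg \<phi>) = bv \<phi>"
| "bv (Conj \<phi> \<psi>) = bv \<phi> \<union> bv \<psi>"
| "bv (Box \<phi>) = bv \<phi>"
| "bv (Mu p \<phi>) = insert p (bv \<phi>)"

text \<open>The hypothesis of \<open>sat_ssubst\<close>. Only free occurrences are tested, so
  \<open>\<sigma>\<close> may be arbitrary at other atoms; under \<open>Mu p\<close> the atom
  \<open>p\<close> is reset because \<open>ssubst\<close> leaves it alone there.\<close>

primrec capture_free :: "('v \<Rightarrow> 'v fm) \<Rightarrow> 'v fm \<Rightarrow> bool" where
  "capture_free \<sigma> (Atom p) \<longleftrightarrow> True"
| "capture_free \<sigma> Top \<longleftrightarrow> True"
| "capture_free \<sigma> (Neg \<phi>) \<longleftrightarrow> capture_free \<sigma> \<phi>"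
| "capture_free \<sigma> (Conj \<phi> \<psi>) \<longleftrightarrow> capture_free \<sigma> \<phi> \<and> capture_free \<sigma> \<psi>"
| "capture_free \<sigma> (Box \<phi>) \<longleftrightarrow> capture_free \<sigma> \<phi>"
| "capture_free \<sigma> (Mu p \<phi>) \<longleftrightarrow>
     (\<forall>q\<in>fv \<phi> - {p}. p \<notin> fv (\<sigma> q)) \<and> capture_free (\<sigma>(p := Atom p)) \<phi>"

lemma finite_fv: "finite (fv \<phi>)"
  by (induction \<phi>) auto

lemma finite_bv: "finite (bv \<phi>)"
  by (induction \<phi>) auto

lemma ssubst_cong:
  "(\<And>p. p \<in> fv \<phi> \<Longrightarrow> \<sigma> p = \<tau> p) \<Longrightarrow> ssubst \<sigma> \<phi> = ssubst \<tau> \<phi>"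
proof (induction \<phi> arbitrary: \<sigma> \<tau>)
  case (Neg \<phi>)
  have "ssubst \<sigma> \<phi> = ssubst \<tau> \<phi>"
    by (rule Neg.IH) (simp add: Neg.prems)
  then show ?case by (simp only: ssubst.simps)
next
  case (Conj \<phi> \<psi>)
  have "ssubst \<sigma> \<phi> = ssubst \<tau> \<phi>"
    by (rule Conj.IH) (simp add: Conj.prems)
  moreover have "ssubst \<sigma> \<psi> = ssubst \<tau> \<psi>"
    by (rule Conj.IH) (simp add: Conj.prems)
  ultimately show ?case by (simp only: ssubst.simps)
next
  case (Box \<phi>)
  have "ssubst \<sigma> \<phi> = ssubst \<tau> \<phi>"
    by (rule Box.IH) (simp add: Box.prems)
  then show ?case by (simp only: ssubst.simps)
next
  case (Mu q \<phi>)
  have "ssubst (\<sigma>(q := Atom q)) \<phi> = ssubst (\<tau>(q := Atom q)) \<phi>"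
    by (rule Mu.IH) (simp add: Mu.prems)
  then show ?case by (simp only: ssubst.simps fv.simps Mu.prems)
qed simp_all

lemma Atom_upd: "Atom(p := Atom p) = Atom"
  by auto

lemma ssubst_Atom [simp]: "ssubst Atom \<phi> = \<phi>"
  by (induction \<phi>) (simp_all add: Atom_upd)

lemma Atom_upd_upd: "(Atom(q := \<psi>))(p := Atom p) = (if p = q then Atom else Atom(q := \<psi>))"
  by auto

text \<open>The axioms use single substitution, but under nested binders all fixed point variables
  are interpreted at once. This lemma and \<open>subst_ssubst\<close> connect the two
  notions.\<close>

lemma subst_eq_ssubst: "subst \<phi> \<psi> q = ssubst (Atom(q := \<psi>)) \<phi>"
proof (induction \<phi>)
  case (Mu p \<phi>)
  show ?case
    by (cases "p = q")
      (simp_all only: subst.simps ssubst.simps Atom_upd_upd Mu.IH ssubst_Atom if_True if_False HOL.refl)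
qed simp_all

lemma capture_free_Atom [simp]: "capture_free Atom \<phi>"
  by (induction \<phi>) (auto simp: Atom_upd)

lemma capture_free_single: "free_for \<psi> q \<phi> \<Longrightarrow> capture_free (Atom(q := \<psi>)) \<phi>"
proof (induction \<phi>)
  case (Mu p \<phi>)
  have "capture_free (Atom(q := \<psi>)) \<phi>" if "p \<noteq> q"
    by (rule Mu.IH) (use Mu.prems that in auto)
  moreover have "\<forall>r\<in>fv \<phi> - {p}. p \<notin> fv ((Atom(q := \<psi>)) r)"
    using Mu.prems by auto
  ultimately show ?case by (simp only: Atom_upd_upd capture_free.simps split: if_split) auto
qed auto

lemma fv_ssubst: "fv (ssubst \<sigma> \<phi>) \<subseteq> (\<Union>p\<in>fv \<phi>. fv (\<sigma> p))"
proof (induction \<phi> arbitrary: \<sigma>)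
  case (Conj \<phi> \<psi>)
  show ?case using Conj.IH(1)[of \<sigma>] Conj.IH(2)[of \<sigma>] by auto
next
  case (Mu q \<phi>)
  have "fv (ssubst (\<sigma>(q := Atom q)) \<phi>) \<subseteq> (\<Union>p\<in>fv \<phi>. fv ((\<sigma>(q := Atom q)) p))"
    by (rule Mu.IH)
  also have "\<dots> \<subseteq> insert q (\<Union>p\<in>fv \<phi> - {q}. fv (\<sigma> p))"
    by (auto split: if_splits)
  finally show ?case by auto
qed simp_all

lemma bv_ssubst: "bv (ssubst \<sigma> \<phi>) \<subseteq> bv \<phi> \<union> (\<Union>p\<in>fv \<phi>. bv (\<sigma> p))"
proof (induction \<phi> arbitrary: \<sigma>)
  case (Conj \<phi> \<psi>)
  show ?case using Conj.IH(1)[of \<sigma>] Conj.IH(2)[of \<sigma>] by auto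
next
  case (Mu q \<phi>)
  have "bv (ssubst (\<sigma>(q := Atom q)) \<phi>) \<subseteq> bv \<phi> \<union> (\<Union>p\<in>fv \<phi>. bv ((\<sigma>(q := Atom q)) p))"
    by (rule Mu.IH)
  also have "\<dots> \<subseteq> bv \<phi> \<union> (\<Union>p\<in>fv \<phi> - {q}. bv (\<sigma> p))"
    by (auto split: if_splits)
  finally show ?case by auto
qed simp_all

lemma occ_parity_notin_fv: "q \<notin> fv \<phi> \<Longrightarrow> occ_parity q b \<phi>"
  by (induction \<phi> arbitrary: b) auto

text \<open>No new free \<open>q\<close> is brought in, so the free occurrences of \<open>q\<close>
  and the negations above them are unchanged. Hence positivity, and with it the right to form
  \<open>Mu q\<close>, survives substitution.\<close>

lemma occ_parity_ssubst:
  "occ_parity q b \<phi> \<Longrightarrow> (\<And>p. p \<in> fv \<phi> - {q} \<Longrightarrow> q \<notin> fv (\<sigma> p)) \<Longrightarrow>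
    occ_parity q b (ssubst (\<sigma>(q := Atom q)) \<phi>)"
proof (induction \<phi> arbitrary: b \<sigma>)
  case (Atom p)
  then show ?case by (auto simp: occ_parity_notin_fv)
next
  case (Mu p \<phi>)
  show ?case
  proof (cases "p = q")
    case False
    then have "occ_parity q b (ssubst ((\<sigma>(p := Atom p))(q := Atom q)) \<phi>)"
      using Mu.prems by (intro Mu.IH) auto
    then show ?thesis using False by (simp only: ssubst.simps occ_parity.simps subst.simps fun_upd_twist[OF False] if_False simp_thms)
  qed simp
qed auto

text \<open>The body of \<open>ssubst \<sigma> (Mu r \<phi>)\<close> is
  \<open>ssubst (\<sigma>(r := Atom r)) \<phi>\<close>. Substituting into this body, as
  \<open>Fix\<close> and \<open>Ind\<close> do, thus becomes an update of \<open>\<sigma>\<close> at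
  \<open>r\<close>.\<close>

lemma subst_ssubst:
  "(\<And>p. p \<in> fv \<phi> - {r} \<Longrightarrow> r \<notin> fv (\<sigma> p)) \<Longrightarrow>
    subst (ssubst (\<sigma>(r := Atom r)) \<phi>) \<beta> r = ssubst (\<sigma>(r := \<beta>)) \<phi>"
proof (induction \<phi> arbitrary: \<sigma>)
  case (Atom p)
  have "ssubst (Atom(r := \<beta>)) (\<sigma> p) = ssubst Atom (\<sigma> p)" if "p \<noteq> r"
    by (rule ssubst_cong) (use Atom that in auto)
  then show ?case by (auto simp: subst_eq_ssubst)
next
  case (Mu p \<phi>)
  show ?case
  proof (cases "p = r")
    case False
    then have "subst (ssubst ((\<sigma>(p := Atom p))(r := Atom r)) \<phi>) \<beta> r
        = ssubst ((\<sigma>(p := Atom p))(r := \<beta>)) \<phi>"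
      using Mu.prems by (intro Mu.IH) auto
    then show ?thesis using False by (simp only: ssubst.simps occ_parity.simps subst.simps fun_upd_twist[OF False] if_False simp_thms)
  next
    case True
    then show ?thesis by (simp only: ssubst.simps subst.simps fun_upd_upd if_True HOL.refl)
  qed
qed auto

lemma free_forI: "fv \<psi> \<inter> bv \<phi> = {} \<Longrightarrow> free_for \<psi> q \<phi>"
  by (induction \<phi>) auto


section \<open>Semantics\<close>

lemma sat_coincidence:
  assumes "R \<subseteq> W \<times> W"
  shows "w \<in> W \<Longrightarrow> (\<And>p. p \<in> fv \<phi> \<Longrightarrow> g p \<inter> W = h p \<inter> W) \<Longrightarrow>
    sat \<phi> W R g w = sat \<phi> W R h w"
proof (induction \<phi> arbitrary: g h w)
  case (Atom p)
  then show ?case by (simp; blast)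
next
  case (Neg \<phi>)
  have "sat \<phi> W R g w = sat \<phi> W R h w" by (rule Neg.IH) (use Neg.prems in auto)
  then show ?case by simp
next
  case (Conj \<phi> \<psi>)
  have "sat \<phi> W R g w = sat \<phi> W R h w" "sat \<psi> W R g w = sat \<psi> W R h w"
    by (rule Conj.IH; use Conj.prems in auto)+
  then show ?case by simp
next
  case (Box \<phi>)
  have "sat \<phi> W R g v = sat \<phi> W R h v" if "v \<in> W" for v
    by (rule Box.IH[OF that]) (use Box.prems in auto)
  then show ?case using assms by auto
next
  case (Mu q \<phi>)
  have "{v \<in> W. sat \<phi> W R (g(q := S)) v} = {v \<in> W. sat \<phi> W R (h(q := S)) v}" for S
  proof -
    have "sat \<phi> W R (g(q := S)) v = sat \<phi> W R (h(q := S)) v" if "v \<in> W" for v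
      by (rule Mu.IH[OF that]) (use Mu.prems in auto)
    then show ?thesis by auto
  qed
  then show ?case by simp
qed simp

lemma sat_ssubst:
  assumes "R \<subseteq> W \<times> W"
  shows "capture_free \<sigma> \<phi> \<Longrightarrow> w \<in> W \<Longrightarrow>
    (\<And>p v. p \<in> fv \<phi> \<Longrightarrow> v \<in> W \<Longrightarrow> v \<in> g p \<longleftrightarrow> sat (\<sigma> p) W R h v) \<Longrightarrow>
    sat (ssubst \<sigma> \<phi>) W R h w = sat \<phi> W R g w"
proof (induction \<phi> arbitrary: \<sigma> g h w)
  case (Conj \<phi> \<psi>)
  have "sat (ssubst \<sigma> \<phi>) W R h w = sat \<phi> W R g w" "sat (ssubst \<sigma> \<psi>) W R h w = sat \<psi> W R g w"
    by (rule Conj.IH; use Conj.prems in auto)+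
  then show ?case by simp
next
  case (Box \<phi>)
  have "sat (ssubst \<sigma> \<phi>) W R h v = sat \<phi> W R g v" if "v \<in> W" for v
    by (rule Box.IH) (use Box.prems that in auto)
  then show ?case using assms by auto
next
  case (Mu q \<phi>)
  have "{v \<in> W. sat (ssubst (\<sigma>(q := Atom q)) \<phi>) W R (h(q := S)) v} =
      {v \<in> W. sat \<phi> W R (g(q := S)) v}" for S
  proof -
    have "sat (ssubst (\<sigma>(q := Atom q)) \<phi>) W R (h(q := S)) v = sat \<phi> W R (g(q := S)) v"
      if "v \<in> W" for v
    proof (rule Mu.IH)
      fix p u assume "p \<in> fv \<phi>" "u \<in> W"
      show "u \<in> (g(q := S)) p \<longleftrightarrow> sat ((\<sigma>(q := Atom q)) p) W R (h(q := S)) u"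
      proof (cases "p = q")
        case False
        \<comment> \<open>Capture-freeness enters here: \<open>q\<close> is not free in
          \<open>\<sigma> p\<close>, so changing \<open>h\<close> at \<open>q\<close> has no
          effect.\<close>
        then have "sat (\<sigma> p) W R (h(q := S)) u = sat (\<sigma> p) W R h u"
          using Mu.prems(1) \<open>p \<in> fv \<phi>\<close> \<open>u \<in> W\<close> by (intro sat_coincidence[OF assms]) auto
        then show ?thesis using False Mu.prems(3) \<open>p \<in> fv \<phi>\<close> \<open>u \<in> W\<close> by simp
      qed simp
    next
      show "capture_free (\<sigma>(q := Atom q)) \<phi>" using Mu.prems(1) by (simp only: capture_free.simps)
    qed (rule that)
    then show ?thesis by auto
  qed
  then show ?case by simp
qed auto

text \<open>All atoms are treated at once, each with its own direction, because \<open>Neg\<close>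
  swaps the directions. The third alternative serves atoms that occur with both parities.\<close>

lemma sat_mono:
  "is_fm \<phi> \<Longrightarrow> (\<And>p. p \<in> fv \<phi> \<Longrightarrow> occ_parity p True \<phi> \<and> g p \<subseteq> h p \<or>
      occ_parity p False \<phi> \<and> h p \<subseteq> g p \<or> g p = h p) \<Longrightarrow>
    sat \<phi> W R g w \<Longrightarrow> sat \<phi> W R h w"
proof (induction \<phi> arbitrary: g h w)
  case (Neg \<phi>)
  have "sat \<phi> W R g w" if "sat \<phi> W R h w"
    by (rule Neg.IH[OF _ _ that]) (use Neg.prems in auto)
  then show ?case using Neg.prems by auto
next
  case (Conj \<phi> \<psi>)
  have "sat \<phi> W R h w"
    by (rule Conj.IH(1)[of g]) (use Conj.prems in auto)
  moreover have "sat \<psi> W R h w"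
    by (rule Conj.IH(2)[of g]) (use Conj.prems in auto)
  ultimately show ?case by simp
next
  case (Box \<phi>)
  have "sat \<phi> W R h v" if "(w, v) \<in> R" for v
    by (rule Box.IH[of g]) (use Box.prems that in auto)
  then show ?case by simp
next
  case (Mu q \<phi>)
  have "{v \<in> W. sat \<phi> W R (g(q := S)) v} \<subseteq> {v \<in> W. sat \<phi> W R (h(q := S)) v}" for S
  proof -
    have "sat \<phi> W R (h(q := S)) v" if "sat \<phi> W R (g(q := S)) v" for v
      by (rule Mu.IH[OF _ _ that]) (use Mu.prems in auto)
    then show ?thesis by auto
  qed
  then have "lfp (\<lambda>S. {v \<in> W. sat \<phi> W R (g(q := S)) v}) \<subseteq> lfp (\<lambda>S. {v \<in> W. sat \<phi> W R (h(q := S)) v})"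
    by (rule lfp_mono)
  then show ?case using Mu.prems by auto
qed auto

lemma mono_Mu:
  fixes W :: "'a set"
  assumes "is_fm \<phi>" "positive q \<phi>"
  shows "mono (\<lambda>S. {v \<in> W. sat \<phi> W R (h(q := S)) v})"
proof (rule monoI)
  fix S T assume "S \<subseteq> (T :: 'a set)"
  have "sat \<phi> W R (h(q := T)) v" if "sat \<phi> W R (h(q := S)) v" for v
    by (rule sat_mono[OF assms(1) _ that]) (use assms \<open>S \<subseteq> T\<close> in auto)
  then show "{v \<in> W. sat \<phi> W R (h(q := S)) v} \<subseteq> {v \<in> W. sat \<phi> W R (h(q := T)) v}" by auto
qed

lemma sat_Mu_unfold:
  assumes "is_fm \<phi>" "positive q \<phi>"
  shows "lfp (\<lambda>S. {v \<in> W. sat \<phi> W R (h(q := S)) v}) =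
    {v \<in> W. sat \<phi> W R (h(q := lfp (\<lambda>S. {v \<in> W. sat \<phi> W R (h(q := S)) v}))) v}"
  by (rule lfp_unfold[OF mono_Mu[OF assms]])

text \<open>Invariance under p-morphisms extends to \<open>Mu\<close> by comparing prefixed points
  in both directions. It is applied to inclusions of generated subframes, to the embeddings of
  models into a larger one, and to isomorphisms.\<close>

lemma sat_p_morphism:
  assumes R: "R \<subseteq> W \<times> W" "R' \<subseteq> W' \<times> W'"
    and f: "\<And>w. w \<in> W \<Longrightarrow> f w \<in> W'"
    and zig: "\<And>v w. (v, w) \<in> R \<Longrightarrow> (f v, f w) \<in> R'"
    and zag: "\<And>v w'. v \<in> W \<Longrightarrow> (f v, w') \<in> R' \<Longrightarrow> \<exists>w. (v, w) \<in> R \<and> f w = w'"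
  shows "is_fm \<phi> \<Longrightarrow> w \<in> W \<Longrightarrow> (\<And>p v. p \<in> fv \<phi> \<Longrightarrow> v \<in> W \<Longrightarrow> v \<in> h p \<longleftrightarrow> f v \<in> h' p) \<Longrightarrow>
    sat \<phi> W R h w = sat \<phi> W' R' h' (f w)"
proof (induction \<phi> arbitrary: h h' w)
  case (Conj \<phi> \<psi>)
  have "sat \<phi> W R h w = sat \<phi> W' R' h' (f w)" "sat \<psi> W R h w = sat \<psi> W' R' h' (f w)"
    by (rule Conj.IH; use Conj.prems in auto)+
  then show ?case by simp
next
  case (Box \<phi>)
  have IH: "sat \<phi> W R h v = sat \<phi> W' R' h' (f v)" if "v \<in> W" for v
    by (rule Box.IH) (use Box.prems that in auto)
  show ?case
  proof
    assume *: "sat (Box \<phi>) W R h w"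
    show "sat (Box \<phi>) W' R' h' (f w)"
      unfolding sat.simps
    proof (intro allI impI)
      fix v' assume "(f w, v') \<in> R'"
      then obtain v where "(w, v) \<in> R" "f v = v'" using zag Box.prems by blast
      then show "sat \<phi> W' R' h' v'" using * IH[of v] R by auto
    qed
  next
    assume *: "sat (Box \<phi>) W' R' h' (f w)"
    show "sat (Box \<phi>) W R h w"
      unfolding sat.simps
    proof (intro allI impI)
      fix v assume "(w, v) \<in> R"
      then show "sat \<phi> W R h v" using * IH[of v] R zig by auto
    qed
  qed
next
  case (Mu q \<phi>)
  define F where "F = (\<lambda>S. {v \<in> W. sat \<phi> W R (h(q := S)) v})"
  define F' where "F' = (\<lambda>S. {v \<in> W'. sat \<phi> W' R' (h'(q := S)) v})"
  have fm: "is_fm \<phi>" "positive q \<phi>" using Mu.prems by auto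
  have eq: "lfp F = F (lfp F)" and eq': "lfp F' = F' (lfp F')"
    unfolding F_def F'_def by (rule lfp_unfold[OF mono_Mu[OF fm]])+
  have IH: "sat \<phi> W R (h(q := {v \<in> W. f v \<in> S'})) v = sat \<phi> W' R' (h'(q := S')) (f v)"
    if "v \<in> W" for S' v
    by (rule Mu.IH) (use Mu.prems that in auto)
  have "lfp F \<subseteq> {v \<in> W. f v \<in> lfp F'}"
  proof (rule lfp_lowerbound)
    show "F {v \<in> W. f v \<in> lfp F'} \<subseteq> {v \<in> W. f v \<in> lfp F'}"
      by (subst eq') (use IH f in \<open>auto simp: F_def F'_def\<close>)
  qed
  moreover
  \<comment> \<open>The largest subset of \<open>W'\<close> whose preimage lies in
    \<open>lfp F\<close>; worlds outside the range of \<open>f\<close> belong to it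
    trivially.\<close>
  define Q where "Q = {w' \<in> W'. \<forall>v\<in>W. f v = w' \<longrightarrow> v \<in> lfp F}"
  have "lfp F' \<subseteq> Q"
  proof (rule lfp_lowerbound, rule subsetI)
    fix w' assume w': "w' \<in> F' Q"
    have "v \<in> lfp F" if v: "v \<in> W" "f v = w'" for v
    proof -
      have "sat \<phi> W R (h(q := {v \<in> W. f v \<in> Q})) v"
        using IH[OF v(1)] v w' by (auto simp: F'_def)
      then have "sat \<phi> W R (h(q := lfp F)) v"
        by (rule sat_mono[OF fm(1), rotated]) (use fm in \<open>auto simp: Q_def\<close>)
      then show ?thesis by (subst eq) (use v in \<open>auto simp: F_def\<close>)
    qed
    then show "w' \<in> Q" using w' by (auto simp: Q_def F'_def)
  qed
  ultimately have "w \<in> lfp F \<longleftrightarrow> f w \<in> lfp F'"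
    using Mu.prems(2) by (auto simp: Q_def)
  then show ?case by (simp add: F_def F'_def)
qed auto

text \<open>An upward closed \<open>U\<close> is a generated subframe, whose inclusion is a
  p-morphism; both sides are compared with truth of \<open>\<phi>\<close> there under
  \<open>g\<close>.\<close>

lemma sat_local:
  assumes R: "R \<subseteq> W \<times> W" and U: "U \<subseteq> W" "\<And>v w. (v, w) \<in> R \<Longrightarrow> v \<in> U \<Longrightarrow> w \<in> U"
    and "is_fm \<phi>" "w \<in> U" "\<And>p. p \<in> fv \<phi> \<Longrightarrow> g p \<inter> U = h p \<inter> U"
  shows "sat \<phi> W R g w = sat \<phi> W R h w"
proof -
  have "sat \<phi> U (R \<inter> U \<times> U) g w = sat \<phi> W R k (id w)"
    if *: "\<And>p. p \<in> fv \<phi> \<Longrightarrow> g p \<inter> U = k p \<inter> U" for k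
  proof (rule sat_p_morphism)
    show "v \<in> g p \<longleftrightarrow> id v \<in> k p" if "p \<in> fv \<phi>" "v \<in> U" for p v
      using * that by auto
  qed (use assms in auto)
  from this[of g] this[of h] show ?thesis using assms by simp
qed


section \<open>Soundness\<close>

lemma sat_inst: "sat (inst \<sigma> t) W R h w = peval (\<lambda>n. sat (\<sigma> n) W R h w) t"
  by (induction t) auto

lemma sat_subst:
  assumes "R \<subseteq> W \<times> W" "free_for \<psi> q \<phi>" "w \<in> W" "\<And>v. v \<in> W \<Longrightarrow> v \<in> S \<longleftrightarrow> sat \<psi> W R h v"
  shows "sat (subst \<phi> \<psi> q) W R h w = sat \<phi> W R (h(q := S)) w"
  unfolding subst_eq_ssubst
  by (rule sat_ssubst[OF assms(1) capture_free_single[OF assms(2)] assms(3)]) (use assms in auto)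

lemma sat_Imp [simp]: "sat (\<phi> \<^bold>\<longrightarrow> \<psi>) W R h w \<longleftrightarrow> (sat \<phi> W R h w \<longrightarrow> sat \<psi> W R h w)"
  by (auto simp: Imp_def)

lemma derivable_sound:
  assumes W: "R \<subseteq> W \<times> W" "refl_on W R" "trans R"
  shows "derivable \<phi> \<Longrightarrow> w \<in> W \<Longrightarrow> sat \<phi> W R h w"
proof (induction \<phi> arbitrary: w h rule: derivable.induct)
  case (Taut t \<sigma>)
  then show ?case by (simp add: sat_inst tautology_def)
next
  case (T \<phi>)
  then show ?case using W by (auto dest: refl_onD)
next
  case (Four \<phi>)
  then show ?case using W by (auto dest: transD)
next
  case (Fix \<phi> q)
  let ?L = "lfp (\<lambda>S. {v \<in> W. sat \<phi> W R (h(q := S)) v})"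
  have "sat (subst \<phi> (Mu q \<phi>) q) W R h w = sat \<phi> W R (h(q := ?L)) w"
    using Fix by (intro sat_subst[OF W(1)]) auto
  then show ?case using sat_Mu_unfold[OF Fix(1,2), of W R h] Fix.prems by auto
next
  case (Nec \<phi>)
  then show ?case using W by auto
next
  case (Ind \<phi> q \<psi>)
  have "{v \<in> W. sat \<phi> W R (h(q := {v \<in> W. sat \<psi> W R h v})) v} \<subseteq> {v \<in> W. sat \<psi> W R h v}"
    (is "?F ?S \<subseteq> ?S")
  proof
    fix v assume v: "v \<in> ?F ?S"
    then have "sat (subst \<phi> \<psi> q) W R h v = sat \<phi> W R (h(q := ?S)) v"
      using Ind by (intro sat_subst[OF W(1)]) auto
    moreover have "v \<in> W" "sat \<phi> W R (h(q := ?S)) v" using v by blast+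
    ultimately show "v \<in> ?S" using Ind.IH[of v h] unfolding sat_Imp by blast
  qed
  then have "lfp (\<lambda>S. {v \<in> W. sat \<phi> W R (h(q := S)) v}) \<subseteq> ?S"
    by (rule lfp_lowerbound)
  then show ?case by auto
qed auto

lemma alpha_eq_sat:
  assumes "R \<subseteq> W \<times> W"
  shows "\<phi> =\<^sub>\<alpha> \<psi> \<Longrightarrow> w \<in> W \<Longrightarrow> sat \<phi> W R h w = sat \<psi> W R h w"
proof (induction \<phi> \<psi> arbitrary: w h rule: alpha_eq.induct)
  case (rename p \<phi> q)
  have "{v \<in> W. sat \<phi> W R (h(q := S)) v} =
      {v \<in> W. sat (subst \<phi> (Atom p) q) W R (h(p := S)) v}" for S
  proof -
    have "sat (subst \<phi> (Atom p) q) W R (h(p := S)) v = sat \<phi> W R (h(p := S, q := S)) v"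
      if "v \<in> W" for v
      by (rule sat_subst[OF assms rename(2) that]) simp
    moreover have "sat \<phi> W R (h(p := S, q := S)) v = sat \<phi> W R (h(q := S)) v" if "v \<in> W" for v
      by (rule sat_coincidence[OF assms that]) (use rename(1) in auto)
    ultimately show ?thesis by auto
  qed
  then show ?case by simp
next
  case (Box \<phi> \<phi>')
  then show ?case using assms by auto
next
  case (Mu \<phi> \<phi>' q)
  have "{v \<in> W. sat \<phi> W R (h(q := S)) v} = {v \<in> W. sat \<phi>' W R (h(q := S)) v}" for S
    using Mu.IH by auto
  then show ?case by simp
qed auto

lemma S4mu_sound: "sound_over S4mu finite_S4_frames"
proof -
  have "sat \<phi> W R h w"
    if "S4mu \<phi>" "R \<subseteq> W \<times> W" "refl_on W R" "trans R" "w \<in> W" for \<phi> W R h w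
    using that alpha_eq_sat[of R W] derivable_sound[of R W] unfolding S4mu_def by blast
  then show ?thesis
    by (auto simp: sound_over_def valid_in_def finite_S4_frames_def)
qed

section \<open>Renaming bound atoms apart\<close>

text \<open>Free atoms outside \<open>A\<close> are allowed: the body of
  \<open>Mu r \<theta>\<close> has to stay clean although \<open>r\<close> is not in
  \<open>A\<close>.\<close>

definition clean :: "'v set \<Rightarrow> 'v fm \<Rightarrow> bool" where
  "clean A \<phi> \<longleftrightarrow> is_fm \<phi> \<and> bv \<phi> \<inter> A = {}"

text \<open>
  Substituting formulas \<open>over A\<close> into \<open>clean A\<close> formulas never captures an atom, so the provisos of
  \<open>Fix\<close> and \<open>Ind\<close> are automatic.
\<close>

definition over :: "'v set \<Rightarrow> 'v fm \<Rightarrow> bool" where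
  "over A \<phi> \<longleftrightarrow> clean A \<phi> \<and> fv \<phi> \<subseteq> A"

lemma rename_atom:
  assumes "p \<noteq> q"
  shows "p \<notin> fv \<phi> \<Longrightarrow> p \<notin> bv \<phi> \<Longrightarrow>
      fv (subst \<phi> (Atom p) q) = (if q \<in> fv \<phi> then insert p (fv \<phi> - {q}) else fv \<phi>)"
    and "bv (subst \<phi> (Atom p) q) = bv \<phi>"
    and "r \<noteq> p \<Longrightarrow> r \<noteq> q \<Longrightarrow> occ_parity r b (subst \<phi> (Atom p) q) = occ_parity r b \<phi>"
    and "p \<notin> fv \<phi> \<Longrightarrow> p \<notin> bv \<phi> \<Longrightarrow> occ_parity p b (subst \<phi> (Atom p) q) = occ_parity q b \<phi>"
proof -
  show "fv (subst \<phi> (Atom p) q) = (if q \<in> fv \<phi> then insert p (fv \<phi> - {q}) else fv \<phi>)"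
    if "p \<notin> fv \<phi>" "p \<notin> bv \<phi>"
    using assms that by (induction \<phi>) auto
  show "bv (subst \<phi> (Atom p) q) = bv \<phi>"
    by (induction \<phi>) auto
  show "occ_parity r b (subst \<phi> (Atom p) q) = occ_parity r b \<phi>" if "r \<noteq> p" "r \<noteq> q"
    using that by (induction \<phi> arbitrary: b) auto
  show "occ_parity p b (subst \<phi> (Atom p) q) = occ_parity q b \<phi>" if "p \<notin> fv \<phi>" "p \<notin> bv \<phi>"
    using assms that by (induction \<phi> arbitrary: b) (auto simp: occ_parity_notin_fv)
qed

lemma is_fm_rename_atom:
  "p \<noteq> q \<Longrightarrow> p \<notin> bv \<phi> \<Longrightarrow> is_fm \<phi> \<Longrightarrow> is_fm (subst \<phi> (Atom p) q)"
  by (induction \<phi>) (auto simp: rename_atom(3))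

text \<open>Binders are renamed from the inside out, each to a fresh atom. Free atoms and parities
  are recorded in the conclusion because the renamed body under a binder must again be
  positive.\<close>

lemma ex_alpha_clean:
  fixes A :: "'v set"
  assumes "infinite (UNIV :: 'v set)" "finite A"
  shows "is_fm \<phi> \<Longrightarrow> \<exists>\<phi>'. \<phi> =\<^sub>\<alpha> \<phi>' \<and> clean A \<phi>' \<and> fv \<phi>' = fv \<phi> \<and>
    (\<forall>q b. occ_parity q b \<phi>' = occ_parity q b \<phi>)"
proof (induction \<phi>)
  case (Neg \<phi>)
  then have "is_fm \<phi>" by simp
  with Neg.IH obtain \<phi>' where "\<phi> =\<^sub>\<alpha> \<phi>'" "clean A \<phi>'" "fv \<phi>' = fv \<phi>"
    "\<forall>q b. occ_parity q b \<phi>' = occ_parity q b \<phi>" by blast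
  then show ?case by (intro exI[of _ "Neg \<phi>'"]) (simp add: clean_def alpha_eq.Neg)
next
  case (Conj \<phi> \<psi>)
  then have "is_fm \<phi>" by simp
  with Conj.IH(1) obtain \<phi>' where "\<phi> =\<^sub>\<alpha> \<phi>'" "clean A \<phi>'" "fv \<phi>' = fv \<phi>"
    "\<forall>q b. occ_parity q b \<phi>' = occ_parity q b \<phi>" by blast
  moreover from Conj.prems Conj.IH(2) obtain \<psi>' where "\<psi> =\<^sub>\<alpha> \<psi>'" "clean A \<psi>'" "fv \<psi>' = fv \<psi>"
    "\<forall>q b. occ_parity q b \<psi>' = occ_parity q b \<psi>" by auto
  ultimately show ?case
    by (intro exI[of _ "Conj \<phi>' \<psi>'"]) (simp add: clean_def alpha_eq.Conj Int_Un_distrib2)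
next
  case (Box \<phi>)
  then have "is_fm \<phi>" by simp
  with Box.IH obtain \<phi>' where "\<phi> =\<^sub>\<alpha> \<phi>'" "clean A \<phi>'" "fv \<phi>' = fv \<phi>"
    "\<forall>q b. occ_parity q b \<phi>' = occ_parity q b \<phi>" by blast
  then show ?case by (intro exI[of _ "Box \<phi>'"]) (simp add: clean_def alpha_eq.Box)
next
  case (Mu q \<phi>)
  then have "is_fm \<phi>" by simp
  with Mu.IH obtain \<phi>' where \<phi>': "\<phi> =\<^sub>\<alpha> \<phi>'" "clean A \<phi>'" "fv \<phi>' = fv \<phi>"
    "\<forall>r b. occ_parity r b \<phi>' = occ_parity r b \<phi>" by blast
  have "finite (A \<union> fv \<phi>' \<union> bv \<phi>' \<union> {q})"
    using assms by (simp add: finite_fv finite_bv)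
  from ex_new_if_finite[OF assms(1) this]
  obtain p where "p \<notin> A \<union> fv \<phi>' \<union> bv \<phi>' \<union> {q}" by (elim exE)
  then have p: "p \<notin> A" "p \<notin> fv \<phi>'" "p \<notin> bv \<phi>'" "p \<noteq> q" by auto
  let ?\<phi> = "subst \<phi>' (Atom p) q"
  have "Mu q \<phi> =\<^sub>\<alpha> Mu q \<phi>'" by (rule alpha_eq.Mu[OF \<phi>'(1)])
  moreover have "Mu q \<phi>' =\<^sub>\<alpha> Mu p ?\<phi>"
    by (rule alpha_eq.rename[OF p(2) free_forI]) (use p in simp)
  ultimately have "Mu q \<phi> =\<^sub>\<alpha> Mu p ?\<phi>" by (rule alpha_eq.trans)
  moreover have "clean A (Mu p ?\<phi>)"
    using p \<phi>'(2) spec[OF spec[OF \<phi>'(4)], of q True] Mu.prems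
    by (simp add: clean_def rename_atom(2)[OF p(4)] rename_atom(4)[OF p(4)] is_fm_rename_atom)
  moreover have "fv (Mu p ?\<phi>) = fv (Mu q \<phi>)"
    using p by (auto simp: rename_atom(1)[OF p(4)] \<phi>'(3))
  moreover have "occ_parity r b (Mu p ?\<phi>) = occ_parity r b (Mu q \<phi>)" for r b
  proof (cases "r = p \<or> r = q")
    case True
    then have "r \<notin> fv (Mu p ?\<phi>)" "r \<notin> fv (Mu q \<phi>)"
      using p by (auto simp: rename_atom(1)[OF p(4)] \<phi>'(3))
    from this[THEN occ_parity_notin_fv] show ?thesis by blast
  next
    case False
    then have "occ_parity r b ?\<phi> = occ_parity r b \<phi>'" by (intro rename_atom(3)[OF p(4)]) auto
    moreover have "occ_parity r b \<phi>' = occ_parity r b \<phi>" using \<phi>'(4) by blast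
    ultimately show ?thesis using False by auto
  qed
  ultimately show ?case by blast
next
  case (Atom p)
  show ?case by (intro exI[of _ "Atom p"]) (simp add: clean_def alpha_eq.refl)
next
  case Top
  show ?case by (intro exI[of _ Top]) (simp add: clean_def alpha_eq.refl)
qed


section \<open>Maximal consistent sets\<close>

lemma is_fm_Imp [simp]: "is_fm (\<phi> \<^bold>\<longrightarrow> \<psi>) \<longleftrightarrow> is_fm \<phi> \<and> is_fm \<psi>"
  by (simp add: Imp_def)

lemma over_simps [simp]:
  "over A Top"
  "over A (Neg \<phi>) \<longleftrightarrow> over A \<phi>"
  "over A (Conj \<phi> \<psi>) \<longleftrightarrow> over A \<phi> \<and> over A \<psi>"
  "over A (\<phi> \<^bold>\<longrightarrow> \<psi>) \<longleftrightarrow> over A \<phi> \<and> over A \<psi>"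
  "over A (Box \<phi>) \<longleftrightarrow> over A \<phi>"
  "over A (Atom p) \<longleftrightarrow> p \<in> A"
  by (auto simp: over_def clean_def Imp_def)

lemma over_is_fm: "over A \<phi> \<Longrightarrow> is_fm \<phi>"
  by (simp add: over_def clean_def)

abbreviation pimp :: "pf \<Rightarrow> pf \<Rightarrow> pf" where
  "pimp t u \<equiv> PNeg (PConj t (PNeg u))"

lemma derivable_instance:
  assumes "is_fm \<alpha>" "is_fm \<beta>" "is_fm \<gamma>" "tautology t"
    and "inst (\<lambda>n. if n = 0 then \<alpha> else if n = 1 then \<beta> else \<gamma>) t = \<phi>"
  shows "derivable \<phi>"
proof -
  have "is_fm (inst (\<lambda>n. if n = 0 then \<alpha> else if n = 1 then \<beta> else \<gamma>) t)"
    using assms(1-3) by (induction t) auto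
  then show ?thesis using derivable.Taut[OF assms(4)] assms(5) by metis
qed

lemma derivable_taut:
  assumes fm: "is_fm \<alpha>" "is_fm \<beta>" "is_fm \<gamma>"
  shows "derivable (\<alpha> \<^bold>\<longrightarrow> \<alpha>)"
    and "derivable (\<alpha> \<^bold>\<longrightarrow> \<beta> \<^bold>\<longrightarrow> \<alpha>)"
    and "derivable ((\<alpha> \<^bold>\<longrightarrow> \<beta> \<^bold>\<longrightarrow> \<gamma>) \<^bold>\<longrightarrow> (\<alpha> \<^bold>\<longrightarrow> \<beta>) \<^bold>\<longrightarrow> \<alpha> \<^bold>\<longrightarrow> \<gamma>)"
    and "derivable ((\<alpha> \<^bold>\<longrightarrow> \<beta>) \<^bold>\<longrightarrow> (Neg \<alpha> \<^bold>\<longrightarrow> \<beta>) \<^bold>\<longrightarrow> \<beta>)"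
    and "derivable (Neg \<alpha> \<^bold>\<longrightarrow> \<alpha> \<^bold>\<longrightarrow> \<beta>)"
    and "derivable (Conj \<alpha> \<beta> \<^bold>\<longrightarrow> \<alpha>)"
    and "derivable (Conj \<alpha> \<beta> \<^bold>\<longrightarrow> \<beta>)"
    and "derivable (\<alpha> \<^bold>\<longrightarrow> \<beta> \<^bold>\<longrightarrow> Conj \<alpha> \<beta>)"
    and "derivable (Top :: 'v fm)"
proof -
  let ?a = "PLetter 0" and ?b = "PLetter 1" and ?c = "PLetter 2"
  note [simp] = tautology_def Imp_def
  show "derivable (\<alpha> \<^bold>\<longrightarrow> \<alpha>)"
    by (rule derivable_instance[OF fm, where t = "pimp ?a ?a"]) auto
  show "derivable (\<alpha> \<^bold>\<longrightarrow> \<beta> \<^bold>\<longrightarrow> \<alpha>)"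
    by (rule derivable_instance[OF fm, where t = "pimp ?a (pimp ?b ?a)"]) auto
  show "derivable ((\<alpha> \<^bold>\<longrightarrow> \<beta> \<^bold>\<longrightarrow> \<gamma>) \<^bold>\<longrightarrow> (\<alpha> \<^bold>\<longrightarrow> \<beta>) \<^bold>\<longrightarrow> \<alpha> \<^bold>\<longrightarrow> \<gamma>)"
    by (rule derivable_instance[OF fm,
        where t = "pimp (pimp ?a (pimp ?b ?c)) (pimp (pimp ?a ?b) (pimp ?a ?c))"]) auto
  show "derivable ((\<alpha> \<^bold>\<longrightarrow> \<beta>) \<^bold>\<longrightarrow> (Neg \<alpha> \<^bold>\<longrightarrow> \<beta>) \<^bold>\<longrightarrow> \<beta>)"
    by (rule derivable_instance[OF fm, where t = "pimp (pimp ?a ?b) (pimp (pimp (PNeg ?a) ?b) ?b)"]) auto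
  show "derivable (Neg \<alpha> \<^bold>\<longrightarrow> \<alpha> \<^bold>\<longrightarrow> \<beta>)"
    by (rule derivable_instance[OF fm, where t = "pimp (PNeg ?a) (pimp ?a ?b)"]) auto
  show "derivable (Conj \<alpha> \<beta> \<^bold>\<longrightarrow> \<alpha>)"
    by (rule derivable_instance[OF fm, where t = "pimp (PConj ?a ?b) ?a"]) auto
  show "derivable (Conj \<alpha> \<beta> \<^bold>\<longrightarrow> \<beta>)"
    by (rule derivable_instance[OF fm, where t = "pimp (PConj ?a ?b) ?b"]) auto
  show "derivable (\<alpha> \<^bold>\<longrightarrow> \<beta> \<^bold>\<longrightarrow> Conj \<alpha> \<beta>)"
    by (rule derivable_instance[OF fm, where t = "pimp ?a (pimp ?b (PConj ?a ?b))"]) auto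
  show "derivable (Top :: 'v fm)"
    by (rule derivable_instance[of Top Top Top PTop]) auto
qed

text \<open>Closure under \<open>MP\<close> but not under \<open>Nec\<close>: these are local
  theories, of the kind satisfied at a single world. Restricting them to formulas over
  \<open>A\<close> rules out capture once and for all.\<close>

definition deductive :: "'v set \<Rightarrow> 'v fm set \<Rightarrow> bool" where
  "deductive A T \<longleftrightarrow> (\<forall>\<phi>\<in>T. over A \<phi>) \<and> (\<forall>\<phi>. over A \<phi> \<longrightarrow> derivable \<phi> \<longrightarrow> \<phi> \<in> T) \<and>
    (\<forall>\<phi> \<psi>. \<phi> \<in> T \<longrightarrow> (\<phi> \<^bold>\<longrightarrow> \<psi>) \<in> T \<longrightarrow> \<psi> \<in> T)"

definition mcs :: "'v set \<Rightarrow> 'v fm set \<Rightarrow> bool" where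
  "mcs A x \<longleftrightarrow> deductive A x \<and> (\<forall>\<phi>. over A \<phi> \<longrightarrow> (Neg \<phi> \<in> x \<longleftrightarrow> \<phi> \<notin> x))"

definition acc :: "'v fm set \<Rightarrow> 'v fm set \<Rightarrow> bool" where
  "acc x z \<longleftrightarrow> (\<forall>\<phi>. Box \<phi> \<in> x \<longrightarrow> \<phi> \<in> z)"

lemma deductive_over: "deductive A T \<Longrightarrow> \<phi> \<in> T \<Longrightarrow> over A \<phi>"
  and deductive_derivable: "deductive A T \<Longrightarrow> derivable \<phi> \<Longrightarrow> over A \<phi> \<Longrightarrow> \<phi> \<in> T"
  and deductive_MP: "deductive A T \<Longrightarrow> (\<phi> \<^bold>\<longrightarrow> \<psi>) \<in> T \<Longrightarrow> \<phi> \<in> T \<Longrightarrow> \<psi> \<in> T"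
  unfolding deductive_def by blast+

text \<open>The set plays the role of the theory generated by \<open>T\<close> and
  \<open>\<alpha>\<close>; defining it by implications builds the deduction theorem in.\<close>

lemma deductive_extend:
  assumes T: "deductive A T" and "over A \<alpha>"
  shows "deductive A {\<beta>. (\<alpha> \<^bold>\<longrightarrow> \<beta>) \<in> T}" "T \<subseteq> {\<beta>. (\<alpha> \<^bold>\<longrightarrow> \<beta>) \<in> T}" "(\<alpha> \<^bold>\<longrightarrow> \<alpha>) \<in> T"
proof -
  have fm: "is_fm \<alpha>" using assms over_is_fm by blast
  show sub: "T \<subseteq> {\<beta>. (\<alpha> \<^bold>\<longrightarrow> \<beta>) \<in> T}"
  proof safe
    fix \<beta> assume \<beta>: "\<beta> \<in> T"
    then have ov: "over A \<beta>" using T deductive_over by blast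
    have "(\<beta> \<^bold>\<longrightarrow> \<alpha> \<^bold>\<longrightarrow> \<beta>) \<in> T"
      using derivable_taut(2)[OF over_is_fm[OF ov] fm fm] assms ov
      by (intro deductive_derivable[OF T]) auto
    then show "(\<alpha> \<^bold>\<longrightarrow> \<beta>) \<in> T" using deductive_MP[OF T] \<beta> by blast
  qed
  show "(\<alpha> \<^bold>\<longrightarrow> \<alpha>) \<in> T"
    using derivable_taut(1)[OF fm fm fm] assms by (intro deductive_derivable[OF T]) auto
  show "deductive A {\<beta>. (\<alpha> \<^bold>\<longrightarrow> \<beta>) \<in> T}"
    unfolding deductive_def
  proof (intro conjI allI impI ballI; (unfold mem_Collect_eq)?)
    fix \<beta> assume "(\<alpha> \<^bold>\<longrightarrow> \<beta>) \<in> T"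
    then show "over A \<beta>" using deductive_over[OF T] by fastforce
  next
    fix \<beta> assume "over A \<beta>" "derivable \<beta>"
    then show "(\<alpha> \<^bold>\<longrightarrow> \<beta>) \<in> T" using sub deductive_derivable[OF T] by blast
  next
    fix \<beta> \<gamma> assume *: "(\<alpha> \<^bold>\<longrightarrow> \<beta>) \<in> T" "(\<alpha> \<^bold>\<longrightarrow> \<beta> \<^bold>\<longrightarrow> \<gamma>) \<in> T"
    then have ov: "over A \<beta>" "over A \<gamma>" using deductive_over[OF T] by fastforce+
    have "((\<alpha> \<^bold>\<longrightarrow> \<beta> \<^bold>\<longrightarrow> \<gamma>) \<^bold>\<longrightarrow> (\<alpha> \<^bold>\<longrightarrow> \<beta>) \<^bold>\<longrightarrow> \<alpha> \<^bold>\<longrightarrow> \<gamma>) \<in> T"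
      using derivable_taut(3)[OF fm over_is_fm[OF ov(1)] over_is_fm[OF ov(2)]] assms ov
      by (intro deductive_derivable[OF T]) auto
    then show "(\<alpha> \<^bold>\<longrightarrow> \<gamma>) \<in> T" using deductive_MP[OF T] * by blast
  qed
qed

text \<open>Lindenbaum: Zorn yields a theory maximal among those omitting \<open>\<phi>\<close>. If
  it contained neither \<open>\<alpha>\<close> nor \<open>Neg \<alpha>\<close>, then by maximality
  both would imply \<open>\<phi>\<close> in it, and so it would contain
  \<open>\<phi>\<close>.\<close>

lemma ex_mcs:
  assumes T: "deductive A T" and \<phi>: "over A \<phi>" "\<phi> \<notin> T"
  obtains x where "mcs A x" "T \<subseteq> x" "\<phi> \<notin> x"
proof -
  let ?F = "{S. deductive A S \<and> T \<subseteq> S \<and> \<phi> \<notin> S}"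
  have "\<exists>M\<in>?F. \<forall>X\<in>?F. M \<subseteq> X \<longrightarrow> X = M"
  proof (rule subset_Zorn_nonempty)
    show "?F \<noteq> {}" using assms by blast
  next
    fix \<C> assume C: "\<C> \<noteq> {}" "subset.chain ?F \<C>"
    then have sub: "\<C> \<subseteq> ?F" and lin: "\<And>X Y. X \<in> \<C> \<Longrightarrow> Y \<in> \<C> \<Longrightarrow> X \<subseteq> Y \<or> Y \<subseteq> X"
      by (auto simp: subset_chain_def)
    have "\<psi> \<in> \<Union>\<C>" if *: "\<chi> \<in> \<Union>\<C>" "(\<chi> \<^bold>\<longrightarrow> \<psi>) \<in> \<Union>\<C>" for \<chi> \<psi>
    proof -
      obtain X Y where XY: "X \<in> \<C>" "\<chi> \<in> X" "Y \<in> \<C>" "(\<chi> \<^bold>\<longrightarrow> \<psi>) \<in> Y" using * by blast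
      then obtain Z where "Z \<in> \<C>" "\<chi> \<in> Z" "(\<chi> \<^bold>\<longrightarrow> \<psi>) \<in> Z" using lin[OF XY(1,3)] by blast
      then show ?thesis using sub deductive_MP by blast
    qed
    moreover have "\<forall>\<psi>\<in>\<Union>\<C>. over A \<psi>" using sub deductive_over by blast
    moreover have "\<psi> \<in> \<Union>\<C>" if "over A \<psi>" "derivable \<psi>" for \<psi>
      using C(1) sub deductive_derivable that by blast
    ultimately have "deductive A (\<Union>\<C>)" unfolding deductive_def by blast
    then show "\<Union>\<C> \<in> ?F" using C(1) sub by blast
  qed
  then obtain x where "x \<in> ?F" and max: "\<forall>X\<in>?F. x \<subseteq> X \<longrightarrow> X = x" by (elim bexE)
  then have x: "deductive A x" "T \<subseteq> x" "\<phi> \<notin> x" by simp_all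
  have imp: "(\<alpha> \<^bold>\<longrightarrow> \<phi>) \<in> x" if \<alpha>: "over A \<alpha>" "\<alpha> \<notin> x" for \<alpha>
  proof (rule ccontr)
    let ?X = "{\<beta>. (\<alpha> \<^bold>\<longrightarrow> \<beta>) \<in> x}"
    note X = deductive_extend[OF x(1) \<alpha>(1)]
    assume "(\<alpha> \<^bold>\<longrightarrow> \<phi>) \<notin> x"
    then have "?X \<in> ?F" using X(1) subset_trans[OF x(2) X(2)] by simp
    then have "?X = x" using max X(2) by simp
    then show False using X(3) \<alpha>(2) by blast
  qed
  have "Neg \<alpha> \<in> x \<longleftrightarrow> \<alpha> \<notin> x" if \<alpha>: "over A \<alpha>" for \<alpha>
  proof
    note fm = over_is_fm[OF \<alpha>] over_is_fm[OF \<phi>(1)] over_is_fm[OF \<phi>(1)]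
    assume "Neg \<alpha> \<in> x"
    moreover have "(Neg \<alpha> \<^bold>\<longrightarrow> \<alpha> \<^bold>\<longrightarrow> \<phi>) \<in> x"
      using derivable_taut(5)[OF fm] \<alpha> \<phi> by (intro deductive_derivable[OF x(1)]) auto
    ultimately show "\<alpha> \<notin> x" using deductive_MP[OF x(1)] x(3) by blast
  next
    note fm = over_is_fm[OF \<alpha>] over_is_fm[OF \<phi>(1)] over_is_fm[OF \<phi>(1)]
    assume "\<alpha> \<notin> x"
    show "Neg \<alpha> \<in> x"
    proof (rule ccontr)
      assume "Neg \<alpha> \<notin> x"
      moreover have "((\<alpha> \<^bold>\<longrightarrow> \<phi>) \<^bold>\<longrightarrow> (Neg \<alpha> \<^bold>\<longrightarrow> \<phi>) \<^bold>\<longrightarrow> \<phi>) \<in> x"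
        using derivable_taut(4)[OF fm] \<alpha> \<phi> by (intro deductive_derivable[OF x(1)]) auto
      ultimately show False
        using imp[of \<alpha>] imp[of "Neg \<alpha>"] \<alpha> \<open>\<alpha> \<notin> x\<close> deductive_MP[OF x(1)] x(3) over_simps(2) by blast
    qed
  qed
  then have "mcs A x" using x(1) by (simp add: mcs_def)
  then show thesis using that x by blast
qed

lemma mcs_deductive: "mcs A x \<Longrightarrow> deductive A x"
  by (simp add: mcs_def)

lemma mcs_derivable: "mcs A x \<Longrightarrow> derivable \<phi> \<Longrightarrow> over A \<phi> \<Longrightarrow> \<phi> \<in> x"
  using deductive_derivable mcs_deductive by blast

lemma mcs_MP: "mcs A x \<Longrightarrow> (\<phi> \<^bold>\<longrightarrow> \<psi>) \<in> x \<Longrightarrow> \<phi> \<in> x \<Longrightarrow> \<psi> \<in> x"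
  using deductive_MP mcs_deductive by blast

lemma mcs_over: "mcs A x \<Longrightarrow> \<phi> \<in> x \<Longrightarrow> over A \<phi>"
  using deductive_over mcs_deductive by blast

lemma mcs_Neg: "mcs A x \<Longrightarrow> over A \<phi> \<Longrightarrow> Neg \<phi> \<in> x \<longleftrightarrow> \<phi> \<notin> x"
  by (simp add: mcs_def)

lemma mcs_Top: "mcs A x \<Longrightarrow> Top \<in> x"
  by (rule mcs_derivable) (auto intro: derivable_taut(9)[of Top Top Top])

lemma mcs_Conj:
  assumes x: "mcs A x" and ov: "over A \<phi>" "over A \<psi>"
  shows "Conj \<phi> \<psi> \<in> x \<longleftrightarrow> \<phi> \<in> x \<and> \<psi> \<in> x"
proof -
  note fm = over_is_fm[OF ov(1)] over_is_fm[OF ov(2)] over_is_fm[OF ov(2)]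
  have "(Conj \<phi> \<psi> \<^bold>\<longrightarrow> \<phi>) \<in> x" "(Conj \<phi> \<psi> \<^bold>\<longrightarrow> \<psi>) \<in> x" "(\<phi> \<^bold>\<longrightarrow> \<psi> \<^bold>\<longrightarrow> Conj \<phi> \<psi>) \<in> x"
    using derivable_taut(6,7,8)[OF fm] ov by (auto intro!: mcs_derivable[OF x])
  then show ?thesis using mcs_MP[OF x] by blast
qed

lemma mcs_Imp:
  "mcs A x \<Longrightarrow> over A \<phi> \<Longrightarrow> over A \<psi> \<Longrightarrow> (\<phi> \<^bold>\<longrightarrow> \<psi>) \<in> x \<longleftrightarrow> (\<phi> \<in> x \<longrightarrow> \<psi> \<in> x)"
  by (simp add: Imp_def mcs_Neg mcs_Conj)

lemma deductive_theorems: "deductive A {\<phi>. over A \<phi> \<and> derivable \<phi>}"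
  unfolding deductive_def by (auto intro: derivable.MP)

text \<open>Allows the premises of \<open>Ind\<close> to be established by arguing about one maximal
  consistent set at a time instead of building derivations.\<close>

lemma derivable_iff_mcs:
  assumes "over A \<phi>"
  shows "derivable \<phi> \<longleftrightarrow> (\<forall>x. mcs A x \<longrightarrow> \<phi> \<in> x)"
proof
  assume "\<forall>x. mcs A x \<longrightarrow> \<phi> \<in> x"
  then show "derivable \<phi>" using ex_mcs[OF deductive_theorems assms] assms by blast
qed (use assms mcs_derivable in blast)

lemma mcs_K: "mcs A x \<Longrightarrow> Box (\<phi> \<^bold>\<longrightarrow> \<psi>) \<in> x \<Longrightarrow> Box \<phi> \<in> x \<Longrightarrow> Box \<psi> \<in> x"
proof -
  assume x: "mcs A x" and *: "Box (\<phi> \<^bold>\<longrightarrow> \<psi>) \<in> x" "Box \<phi> \<in> x"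
  have ov: "over A \<phi>" "over A \<psi>" using mcs_over[OF x *(1)] by simp_all
  have "(Box (\<phi> \<^bold>\<longrightarrow> \<psi>) \<^bold>\<longrightarrow> (Box \<phi> \<^bold>\<longrightarrow> Box \<psi>)) \<in> x"
    using derivable.K[OF ov[THEN over_is_fm]] ov by (intro mcs_derivable[OF x]) simp_all
  from mcs_MP[OF x mcs_MP[OF x this *(1)] *(2)] show ?thesis .
qed

lemma mcs_Box:
  assumes x: "mcs A x" and \<phi>: "over A \<phi>"
  shows "Box \<phi> \<in> x \<longleftrightarrow> (\<forall>z. mcs A z \<longrightarrow> acc x z \<longrightarrow> \<phi> \<in> z)"
proof
  assume *: "\<forall>z. mcs A z \<longrightarrow> acc x z \<longrightarrow> \<phi> \<in> z"
  show "Box \<phi> \<in> x"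
  proof (rule ccontr)
    assume "Box \<phi> \<notin> x"
    moreover have "over A \<beta>" if "Box \<beta> \<in> x" for \<beta>
      using mcs_over[OF x that] by simp
    then have "deductive A {\<beta>. Box \<beta> \<in> x}"
      unfolding deductive_def
      using mcs_K[OF x] mcs_derivable[OF x derivable.Nec] by auto
    ultimately obtain z where "mcs A z" "{\<beta>. Box \<beta> \<in> x} \<subseteq> z" "\<phi> \<notin> z"
      using ex_mcs[of A "{\<beta>. Box \<beta> \<in> x}" \<phi>] \<phi> by blast
    then show False using * by (auto simp: acc_def)
  qed
qed (auto simp: acc_def)

lemma mcs_T: "mcs A x \<Longrightarrow> Box \<phi> \<in> x \<Longrightarrow> \<phi> \<in> x"
proof -
  assume x: "mcs A x" and *: "Box \<phi> \<in> x"
  have ov: "over A \<phi>" using mcs_over[OF x *] by simp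
  have "(Box \<phi> \<^bold>\<longrightarrow> \<phi>) \<in> x"
    using derivable.T[OF over_is_fm[OF ov]] ov by (intro mcs_derivable[OF x]) simp_all
  from mcs_MP[OF x this *] show ?thesis .
qed

lemma mcs_Four: "mcs A x \<Longrightarrow> Box \<phi> \<in> x \<Longrightarrow> Box (Box \<phi>) \<in> x"
proof -
  assume x: "mcs A x" and *: "Box \<phi> \<in> x"
  have ov: "over A \<phi>" using mcs_over[OF x *] by simp
  have "(Box \<phi> \<^bold>\<longrightarrow> Box (Box \<phi>)) \<in> x"
    using derivable.Four[OF over_is_fm[OF ov]] ov by (intro mcs_derivable[OF x]) simp_all
  from mcs_MP[OF x this *] show ?thesis .
qed

lemma acc_refl: "mcs A x \<Longrightarrow> acc x x"
  unfolding acc_def using mcs_T by blast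

lemma acc_trans: "mcs A x \<Longrightarrow> acc x y \<Longrightarrow> acc y z \<Longrightarrow> acc x z"
  unfolding acc_def using mcs_Four by blast

section \<open>Properties of maximal consistent sets that a formula expresses\<close>

definition definable :: "'v set \<Rightarrow> ('v fm set \<Rightarrow> bool) \<Rightarrow> bool" where
  "definable A P \<longleftrightarrow> (\<exists>\<delta>. over A \<delta> \<and> (\<forall>x. mcs A x \<longrightarrow> (\<delta> \<in> x \<longleftrightarrow> P x)))"

lemma definable_mem: "over A \<phi> \<Longrightarrow> definable A (\<lambda>x. \<phi> \<in> x)"
  by (auto simp: definable_def)

lemma definable_const: "definable A (\<lambda>x. b)"
proof (cases b)
  case True
  then show ?thesis unfolding definable_def by (intro exI[of _ Top]) (simp add: mcs_Top)
next
  case False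
  then show ?thesis unfolding definable_def
    by (intro exI[of _ "Neg Top"]) (simp add: mcs_Top mcs_Neg)
qed

lemma definableE:
  assumes "definable A P"
  obtains \<delta> where "over A \<delta>" "\<And>x. mcs A x \<Longrightarrow> \<delta> \<in> x \<longleftrightarrow> P x"
proof -
  from assms obtain \<delta> where "over A \<delta>" "\<forall>x. mcs A x \<longrightarrow> (\<delta> \<in> x \<longleftrightarrow> P x)"
    unfolding definable_def by (elim exE conjE)
  then show thesis by (intro that[of \<delta>]) simp_all
qed

lemma definable_not: "definable A P \<Longrightarrow> definable A (\<lambda>x. \<not> P x)"
proof (erule definableE)
  fix \<delta> assume "over A \<delta>" "\<And>x. mcs A x \<Longrightarrow> \<delta> \<in> x \<longleftrightarrow> P x"
  then show ?thesis unfolding definable_def by (intro exI[of _ "Neg \<delta>"]) (simp add: mcs_Neg)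
qed

lemma definable_conj: "definable A P \<Longrightarrow> definable A Q \<Longrightarrow> definable A (\<lambda>x. P x \<and> Q x)"
proof (erule definableE, erule definableE)
  fix \<delta> \<epsilon> assume "over A \<delta>" "\<And>x. mcs A x \<Longrightarrow> \<delta> \<in> x \<longleftrightarrow> P x"
    "over A \<epsilon>" "\<And>x. mcs A x \<Longrightarrow> \<epsilon> \<in> x \<longleftrightarrow> Q x"
  then show ?thesis unfolding definable_def by (intro exI[of _ "Conj \<delta> \<epsilon>"]) (simp add: mcs_Conj)
qed

lemma definable_disj: "definable A P \<Longrightarrow> definable A Q \<Longrightarrow> definable A (\<lambda>x. P x \<or> Q x)"
  using definable_not[OF definable_conj[OF definable_not definable_not], of A P Q] by simp

lemma definable_iff: "definable A P \<Longrightarrow> definable A Q \<Longrightarrow> definable A (\<lambda>x. P x \<longleftrightarrow> Q x)"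
proof -
  assume "definable A P" "definable A Q"
  then have "definable A (\<lambda>x. (P x \<and> Q x) \<or> (\<not> P x \<and> \<not> Q x))"
    by (intro definable_disj definable_conj definable_not)
  moreover have "(\<lambda>x. (P x \<and> Q x) \<or> (\<not> P x \<and> \<not> Q x)) = (\<lambda>x. P x \<longleftrightarrow> Q x)" by auto
  ultimately show ?thesis by simp
qed

lemma definable_all: "finite I \<Longrightarrow> (\<And>i. i \<in> I \<Longrightarrow> definable A (P i)) \<Longrightarrow> definable A (\<lambda>x. \<forall>i\<in>I. P i x)"
  by (induction I rule: finite_induct) (auto simp: definable_const intro: definable_conj)

lemma definable_ex: "finite I \<Longrightarrow> (\<And>i. i \<in> I \<Longrightarrow> definable A (P i)) \<Longrightarrow> definable A (\<lambda>x. \<exists>i\<in>I. P i x)"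
  by (induction I rule: finite_induct) (auto simp: definable_const intro: definable_disj)

lemma definable_box:
  "definable A P \<Longrightarrow> definable A (\<lambda>x. \<forall>z. mcs A z \<longrightarrow> acc x z \<longrightarrow> P z)"
proof (erule definableE)
  fix \<delta> assume "over A \<delta>" "\<And>x. mcs A x \<Longrightarrow> \<delta> \<in> x \<longleftrightarrow> P x"
  then show ?thesis unfolding definable_def by (intro exI[of _ "Box \<delta>"]) (simp add: mcs_Box)
qed

text \<open>Only the finitely many members of \<open>D\<close> below \<open>\<Sigma>\<close> matter,
  so every set of types is definable. This makes arbitrary subsets of a cluster available to
  \<open>Ind\<close>.\<close>

lemma definable_type:
  assumes "finite \<Sigma>" "\<And>\<phi>. \<phi> \<in> \<Sigma> \<Longrightarrow> over A \<phi>"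
  shows "definable A (\<lambda>x. x \<inter> \<Sigma> \<in> D)"
proof -
  have "(x \<inter> \<Sigma> \<in> D) = (\<exists>t \<in> D \<inter> Pow \<Sigma>. \<forall>\<phi>\<in>\<Sigma>. \<phi> \<in> x \<longleftrightarrow> \<phi> \<in> t)" for x
  proof
    assume "\<exists>t \<in> D \<inter> Pow \<Sigma>. \<forall>\<phi>\<in>\<Sigma>. \<phi> \<in> x \<longleftrightarrow> \<phi> \<in> t"
    then obtain t where "t \<in> D" "t \<subseteq> \<Sigma>" "\<forall>\<phi>\<in>\<Sigma>. \<phi> \<in> x \<longleftrightarrow> \<phi> \<in> t" by blast
    moreover from this have "x \<inter> \<Sigma> = t" by blast
    ultimately show "x \<inter> \<Sigma> \<in> D" by simp
  qed (auto intro!: bexI[of _ "x \<inter> \<Sigma>"])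
  moreover have "definable A (\<lambda>x. \<exists>t \<in> D \<inter> Pow \<Sigma>. \<forall>\<phi>\<in>\<Sigma>. \<phi> \<in> x \<longleftrightarrow> \<phi> \<in> t)"
    by (intro definable_ex definable_all definable_iff definable_mem definable_const)
      (use assms in simp_all)
  ultimately show ?thesis by simp
qed

section \<open>Fixed points in maximal consistent sets\<close>

lemma clean_simps [simp]:
  "clean A (Atom p)" "clean A Top"
  "clean A (Neg \<phi>) \<longleftrightarrow> clean A \<phi>"
  "clean A (Conj \<phi> \<psi>) \<longleftrightarrow> clean A \<phi> \<and> clean A \<psi>"
  "clean A (Box \<phi>) \<longleftrightarrow> clean A \<phi>"
  "clean A (Mu r \<phi>) \<longleftrightarrow> clean A \<phi> \<and> positive r \<phi> \<and> r \<notin> A"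
  by (auto simp: clean_def)

text \<open>The alternative \<open>\<sigma> p = Atom p\<close> accommodates atoms bound further out,
  which lie outside \<open>A\<close>. Positivity at a binder \<open>r\<close> survives since neither
  such an atom other than \<open>r\<close> nor a formula over \<open>A\<close> has \<open>r\<close>
  free.\<close>

lemma clean_ssubst:
  "clean A \<psi> \<Longrightarrow> \<forall>p\<in>fv \<psi>. \<sigma> p = Atom p \<or> over A (\<sigma> p) \<Longrightarrow>
    is_fm (ssubst \<sigma> \<psi>) \<and> capture_free \<sigma> \<psi>"
proof (induction \<psi> arbitrary: \<sigma>)
  case (Mu r \<theta>)
  have IH: "is_fm (ssubst (\<sigma>(r := Atom r)) \<theta>) \<and> capture_free (\<sigma>(r := Atom r)) \<theta>"
    using Mu.prems by (intro Mu.IH) auto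
  have fresh: "r \<notin> fv (\<sigma> p)" if "p \<in> fv \<theta> - {r}" for p
  proof -
    have "\<sigma> p = Atom p \<or> over A (\<sigma> p)" "r \<notin> A" using Mu.prems that by simp_all
    then show ?thesis using that by (auto simp: over_def)
  qed
  have "positive r (ssubst (\<sigma>(r := Atom r)) \<theta>)"
    using Mu.prems by (intro occ_parity_ssubst fresh) simp_all
  then show ?case using IH fresh by simp
qed (auto dest: over_is_fm)

lemma over_ssubst:
  assumes "clean A \<psi>" "\<forall>p\<in>fv \<psi>. over A (\<sigma> p)"
  shows "over A (ssubst \<sigma> \<psi>)"
proof -
  have "fv (ssubst \<sigma> \<psi>) \<subseteq> A" "bv (ssubst \<sigma> \<psi>) \<inter> A = {}"
    using fv_ssubst[of \<sigma> \<psi>] bv_ssubst[of \<sigma> \<psi>] assms by (fastforce simp: over_def clean_def)+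
  then show ?thesis using clean_ssubst[OF assms(1)] assms(2) by (simp add: over_def clean_def)
qed

text \<open>\<open>Fix\<close> and \<open>Ind\<close> in terms of \<open>ssubst\<close>: the
  provisos hold as everything substituted is over \<open>A\<close>, and \<open>subst_ssubst\<close>
  turns the substitution for \<open>r\<close> into an update of \<open>\<sigma>\<close>.\<close>

lemma
  assumes cl: "clean A (Mu r \<theta>)" and \<sigma>: "\<forall>p\<in>fv (Mu r \<theta>). over A (\<sigma> p)"
  shows derivable_unfold:
      "derivable (ssubst (\<sigma>(r := ssubst \<sigma> (Mu r \<theta>))) \<theta> \<^bold>\<longrightarrow> ssubst \<sigma> (Mu r \<theta>))"
    and derivable_induct: "over A \<beta> \<Longrightarrow> derivable (ssubst (\<sigma>(r := \<beta>)) \<theta> \<^bold>\<longrightarrow> \<beta>) \<Longrightarrow>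
      derivable (ssubst \<sigma> (Mu r \<theta>) \<^bold>\<longrightarrow> \<beta>)"
proof -
  let ?\<chi> = "ssubst (\<sigma>(r := Atom r)) \<theta>"
  have ov: "over A (Mu r ?\<chi>)" using over_ssubst[OF cl \<sigma>] by simp
  then have \<chi>: "is_fm ?\<chi>" "positive r ?\<chi>" and bv: "bv ?\<chi> \<inter> A = {}"
    by (auto simp: over_def clean_def)
  have free: "free_for \<beta> r ?\<chi>" if "over A \<beta>" for \<beta>
    using that bv by (intro free_forI) (auto simp: over_def)
  have "r \<notin> A" using cl by simp
  then have "r \<notin> fv (\<sigma> p)" if "p \<in> fv \<theta> - {r}" for p
    using \<sigma> that by (auto simp: over_def)
  then have sub: "subst ?\<chi> \<beta> r = ssubst (\<sigma>(r := \<beta>)) \<theta>" for \<beta>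
    by (rule subst_ssubst)
  show "derivable (ssubst (\<sigma>(r := ssubst \<sigma> (Mu r \<theta>))) \<theta> \<^bold>\<longrightarrow> ssubst \<sigma> (Mu r \<theta>))"
    using derivable.Fix[OF \<chi> free[OF ov]] by (simp only: sub ssubst.simps)
  show "derivable (ssubst \<sigma> (Mu r \<theta>) \<^bold>\<longrightarrow> \<beta>)"
    if "over A \<beta>" "derivable (ssubst (\<sigma>(r := \<beta>)) \<theta> \<^bold>\<longrightarrow> \<beta>)"
    using derivable.Ind[OF \<chi> over_is_fm[OF that(1)] free[OF that(1)]] that(2)
    by (simp only: sub ssubst.simps)
qed

lemma over_upd:
  "\<forall>p\<in>fv (Mu r \<theta>). over A (\<sigma> p) \<Longrightarrow> over A \<beta> \<Longrightarrow> \<forall>p\<in>fv \<theta>. over A ((\<sigma>(r := \<beta>)) p)"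
  by simp

lemma over_unfold:
  assumes "clean A (Mu r \<theta>)" "\<forall>p\<in>fv (Mu r \<theta>). over A (\<sigma> p)" "over A \<beta>"
  shows "over A (ssubst (\<sigma>(r := \<beta>)) \<theta>)"
  using assms(1) over_upd[OF assms(2,3)] by (intro over_ssubst) simp_all

lemma mcs_unfold:
  assumes "mcs A x" "clean A (Mu r \<theta>)" "\<forall>p\<in>fv (Mu r \<theta>). over A (\<sigma> p)"
    and "ssubst (\<sigma>(r := ssubst \<sigma> (Mu r \<theta>))) \<theta> \<in> x"
  shows "ssubst \<sigma> (Mu r \<theta>) \<in> x"
proof -
  have ov: "over A (ssubst \<sigma> (Mu r \<theta>))" by (rule over_ssubst[OF assms(2,3)])
  then have "over A (ssubst (\<sigma>(r := ssubst \<sigma> (Mu r \<theta>))) \<theta> \<^bold>\<longrightarrow> ssubst \<sigma> (Mu r \<theta>))"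
    using over_unfold[OF assms(2,3)] by simp
  from mcs_MP[OF assms(1) mcs_derivable[OF assms(1) derivable_unfold[OF assms(2,3)] this] assms(4)]
  show ?thesis .
qed

section \<open>Monotonicity and induction under assumptions and above a given set\<close>

definition le_under :: "'v set \<Rightarrow> 'v fm \<Rightarrow> 'v fm \<Rightarrow> 'v fm \<Rightarrow> bool" where
  "le_under A \<gamma> \<alpha> \<beta> \<longleftrightarrow> (\<forall>x. mcs A x \<longrightarrow> \<gamma> \<in> x \<longrightarrow> \<alpha> \<in> x \<longrightarrow> \<beta> \<in> x)"

text \<open>The syntactic counterpart of the hypothesis of \<open>sat_mono\<close>, with the same
  three alternatives and an order on formulas in place of inclusion.\<close>

definition subst_le :: "('v fm \<Rightarrow> 'v fm \<Rightarrow> bool) \<Rightarrow> 'v fm \<Rightarrow> ('v \<Rightarrow> 'v fm) \<Rightarrow> ('v \<Rightarrow> 'v fm) \<Rightarrow> bool"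
  where "subst_le le \<psi> \<sigma> \<tau> \<longleftrightarrow> (\<forall>p\<in>fv \<psi>.
     occ_parity p True \<psi> \<and> le (\<sigma> p) (\<tau> p) \<or> occ_parity p False \<psi> \<and> le (\<tau> p) (\<sigma> p) \<or>
     le (\<sigma> p) (\<tau> p) \<and> le (\<tau> p) (\<sigma> p))"

text \<open>The assumption \<open>\<gamma>\<close> has to be persistent so that it is still
  available at the sets seen in the \<open>Box\<close> case.\<close>

lemma ssubst_mono_under:
  assumes \<gamma>: "over A \<gamma>" "\<forall>x. mcs A x \<longrightarrow> \<gamma> \<in> x \<longrightarrow> Box \<gamma> \<in> x"
  shows "clean A \<psi> \<Longrightarrow> \<forall>p\<in>fv \<psi>. over A (\<sigma> p) \<Longrightarrow> \<forall>p\<in>fv \<psi>. over A (\<tau> p) \<Longrightarrow>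
    subst_le (le_under A \<gamma>) \<psi> \<sigma> \<tau> \<Longrightarrow> le_under A \<gamma> (ssubst \<sigma> \<psi>) (ssubst \<tau> \<psi>)"
proof (induction \<psi> arbitrary: \<sigma> \<tau>)
  case (Atom p)
  then show ?case by (auto simp: subst_le_def)
next
  case Top
  then show ?case by (simp add: le_under_def)
next
  case (Neg \<psi>)
  have "subst_le (le_under A \<gamma>) \<psi> \<tau> \<sigma>"
    using Neg.prems(4) unfolding subst_le_def by (simp, blast)
  then have "le_under A \<gamma> (ssubst \<tau> \<psi>) (ssubst \<sigma> \<psi>)"
    using Neg.prems by (intro Neg.IH) simp_all
  moreover have "over A (ssubst \<sigma> \<psi>)" "over A (ssubst \<tau> \<psi>)"
    using Neg.prems by (simp_all add: over_ssubst)
  ultimately show ?case by (simp add: le_under_def mcs_Neg) blast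
next
  case (Conj \<phi> \<psi>)
  have "subst_le (le_under A \<gamma>) \<phi> \<sigma> \<tau>" "subst_le (le_under A \<gamma>) \<psi> \<sigma> \<tau>"
    using Conj.prems(4) unfolding subst_le_def by (simp, blast)+
  then have "le_under A \<gamma> (ssubst \<sigma> \<phi>) (ssubst \<tau> \<phi>)" "le_under A \<gamma> (ssubst \<sigma> \<psi>) (ssubst \<tau> \<psi>)"
    using Conj.prems Conj.IH by simp_all
  moreover have "over A (ssubst \<sigma> \<phi>)" "over A (ssubst \<tau> \<phi>)" "over A (ssubst \<sigma> \<psi>)" "over A (ssubst \<tau> \<psi>)"
    using Conj.prems by (simp_all add: over_ssubst)
  ultimately show ?case by (simp add: le_under_def mcs_Conj)
next
  case (Box \<psi>)
  have "subst_le (le_under A \<gamma>) \<psi> \<sigma> \<tau>"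
    using Box.prems(4) unfolding subst_le_def by simp
  then have IH: "le_under A \<gamma> (ssubst \<sigma> \<psi>) (ssubst \<tau> \<psi>)"
    using Box.prems by (intro Box.IH) simp_all
  have "over A (ssubst \<sigma> \<psi>)" "over A (ssubst \<tau> \<psi>)"
    using Box.prems by (simp_all add: over_ssubst)
  then show ?case
    using IH \<gamma>(2) by (simp add: le_under_def mcs_Box) (meson acc_def)
next
  case (Mu r \<theta>)
  let ?\<mu> = "ssubst \<tau> (Mu r \<theta>)"
  \<comment> \<open>\<open>Ind\<close> admits no side assumptions, so \<open>\<gamma>\<close> is
    moved into the invariant. Under \<open>\<gamma>\<close> the invariant implies
    \<open>?\<mu>\<close>, which is enough because \<open>r\<close> is positive in
    \<open>\<theta>\<close>.\<close>
  let ?\<beta> = "\<gamma> \<^bold>\<longrightarrow> ?\<mu>"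
  have ov\<mu>: "over A ?\<mu>" by (rule over_ssubst[OF Mu.prems(1,3)])
  then have ov\<beta>: "over A ?\<beta>" using \<gamma>(1) by simp
  have \<beta>\<mu>: "le_under A \<gamma> ?\<beta> ?\<mu>" using mcs_MP by (auto simp: le_under_def)
  have "subst_le (le_under A \<gamma>) \<theta> (\<sigma>(r := ?\<beta>)) (\<tau>(r := ?\<mu>))"
    unfolding subst_le_def
  proof
    fix p assume p: "p \<in> fv \<theta>"
    let ?\<sigma> = "\<sigma>(r := ?\<beta>)" and ?\<tau> = "\<tau>(r := ?\<mu>)" and ?le = "le_under A \<gamma>"
    show "occ_parity p True \<theta> \<and> ?le (?\<sigma> p) (?\<tau> p) \<or> occ_parity p False \<theta> \<and> ?le (?\<tau> p) (?\<sigma> p) \<or>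
      ?le (?\<sigma> p) (?\<tau> p) \<and> ?le (?\<tau> p) (?\<sigma> p)"
    proof (cases "p = r")
      case True
      then show ?thesis using \<beta>\<mu> Mu.prems(1) by simp
    next
      case False
      then have "p \<in> fv (Mu r \<theta>)" using p by simp
      from bspec[OF Mu.prems(4)[unfolded subst_le_def] this] show ?thesis
        using False not_sym[OF False] by (simp only: occ_parity.simps fun_upd_other[OF False] simp_thms)
    qed
  qed
  moreover have "clean A \<theta>" using Mu.prems(1) by simp
  ultimately have IH: "le_under A \<gamma> (ssubst (\<sigma>(r := ?\<beta>)) \<theta>) (ssubst (\<tau>(r := ?\<mu>)) \<theta>)"
    using Mu.IH[of "\<sigma>(r := ?\<beta>)" "\<tau>(r := ?\<mu>)"] over_upd[OF Mu.prems(2) ov\<beta>]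
      over_upd[OF Mu.prems(3) ov\<mu>] by blast
  have ov: "over A (ssubst (\<sigma>(r := ?\<beta>)) \<theta>)" by (rule over_unfold[OF Mu.prems(1,2) ov\<beta>])
  have step: "?\<beta> \<in> x" if x: "mcs A x" "ssubst (\<sigma>(r := ?\<beta>)) \<theta> \<in> x" for x
  proof (subst mcs_Imp[OF x(1) \<gamma>(1) ov\<mu>], rule impI)
    assume "\<gamma> \<in> x"
    then have "ssubst (\<tau>(r := ?\<mu>)) \<theta> \<in> x" using IH x by (simp add: le_under_def)
    then show "?\<mu> \<in> x" by (rule mcs_unfold[OF x(1) Mu.prems(1,3)])
  qed
  have "derivable (ssubst (\<sigma>(r := ?\<beta>)) \<theta> \<^bold>\<longrightarrow> ?\<beta>)"
    by (rule iffD2[OF derivable_iff_mcs]) (use step ov ov\<beta> mcs_Imp[OF _ ov ov\<beta>] over_simps(4) in blast)+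
  from derivable_induct[OF Mu.prems(1,2) ov\<beta> this]
  have "derivable (ssubst \<sigma> (Mu r \<theta>) \<^bold>\<longrightarrow> ?\<beta>)" .
  moreover have "over A (ssubst \<sigma> (Mu r \<theta>) \<^bold>\<longrightarrow> ?\<beta>)"
    using over_ssubst[OF Mu.prems(1,2)] ov\<beta> by simp
  ultimately have "?\<beta> \<in> x" if "mcs A x" "ssubst \<sigma> (Mu r \<theta>) \<in> x" for x
    using that mcs_MP mcs_derivable by blast
  then show ?case using mcs_MP unfolding le_under_def by blast
qed

text \<open>Here the assumption is a whole maximal consistent set rather than one formula, so
  \<open>Ind\<close> cannot take it up directly; the next lemmas reduce it to a formula.\<close>

definition le_at :: "'v set \<Rightarrow> 'v fm set \<Rightarrow> 'v fm \<Rightarrow> 'v fm \<Rightarrow> bool" where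
  "le_at A y \<alpha> \<beta> \<longleftrightarrow> (\<forall>z. mcs A z \<longrightarrow> acc y z \<longrightarrow> \<alpha> \<in> z \<longrightarrow> \<beta> \<in> z)"

lemma definable_imp: "definable A P \<Longrightarrow> definable A Q \<Longrightarrow> definable A (\<lambda>x. P x \<longrightarrow> Q x)"
  unfolding imp_conv_disj by (intro definable_disj definable_not)

text \<open>\<open>\<gamma>\<close> is a boxed formula, persistent by transitivity of
  \<open>acc\<close>, hence an assumption that \<open>ssubst_mono_under\<close> accepts.\<close>

lemma definable_upward:
  assumes "definable A P"
  obtains \<gamma> where "over A \<gamma>" "\<forall>x. mcs A x \<longrightarrow> \<gamma> \<in> x \<longrightarrow> Box \<gamma> \<in> x"
    "\<forall>x. mcs A x \<longrightarrow> (\<gamma> \<in> x \<longleftrightarrow> (\<forall>z. mcs A z \<longrightarrow> acc x z \<longrightarrow> P z))"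
proof -
  obtain \<gamma> where ov: "over A \<gamma>"
    and \<gamma>: "\<forall>x. mcs A x \<longrightarrow> (\<gamma> \<in> x \<longleftrightarrow> (\<forall>z. mcs A z \<longrightarrow> acc x z \<longrightarrow> P z))"
    using definable_box[OF assms] unfolding definable_def by (elim exE conjE)
  have "Box \<gamma> \<in> x" if x: "mcs A x" "\<gamma> \<in> x" for x
  proof (subst mcs_Box[OF x(1) ov], intro allI impI)
    fix z assume z: "mcs A z" "acc x z"
    have "P u" if "mcs A u" "acc z u" for u
      using \<gamma> x acc_trans[OF x(1) z(2) that(2)] that(1) by blast
    then show "\<gamma> \<in> z" using \<gamma> z(1) by blast
  qed
  then show thesis using that ov \<gamma> by blast
qed

lemma ssubst_mono_at:
  assumes y: "mcs A y" and cl: "clean A \<psi>"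
    and \<sigma>: "\<forall>p\<in>fv \<psi>. over A (\<sigma> p)" and \<tau>: "\<forall>p\<in>fv \<psi>. over A (\<tau> p)"
    and le: "subst_le (le_at A y) \<psi> \<sigma> \<tau>"
  shows "le_at A y (ssubst \<sigma> \<psi>) (ssubst \<tau> \<psi>)"
proof -
  \<comment> \<open>Collects those implications between \<open>\<sigma> p\<close> and
    \<open>\<tau> p\<close> that hold throughout the sets above \<open>y\<close>. The guards
    \<open>le_at\<close> do not depend on \<open>z\<close>, hence count as constants, and there are
    finitely many \<open>p\<close>; so \<open>P\<close> is definable.\<close>
  define P where "P = (\<lambda>z. \<forall>p\<in>fv \<psi>. (le_at A y (\<sigma> p) (\<tau> p) \<longrightarrow> \<sigma> p \<in> z \<longrightarrow> \<tau> p \<in> z) \<and>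
      (le_at A y (\<tau> p) (\<sigma> p) \<longrightarrow> \<tau> p \<in> z \<longrightarrow> \<sigma> p \<in> z))"
  have "definable A P"
    unfolding P_def
    by (intro definable_all finite_fv definable_conj definable_imp definable_const definable_mem)
      (use \<sigma> \<tau> in simp_all)
  then obtain \<gamma> where \<gamma>: "over A \<gamma>" "\<forall>x. mcs A x \<longrightarrow> \<gamma> \<in> x \<longrightarrow> Box \<gamma> \<in> x"
    and mem: "\<forall>x. mcs A x \<longrightarrow> (\<gamma> \<in> x \<longleftrightarrow> (\<forall>z. mcs A z \<longrightarrow> acc x z \<longrightarrow> P z))"
    by (rule definable_upward)
  have Py: "P z" if "mcs A z" "acc y z" for z
    using that unfolding P_def le_at_def by blast
  have P: "P x" if "mcs A x" "\<gamma> \<in> x" for x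
    using mem that acc_refl[OF that(1)] by blast
  have "subst_le (le_under A \<gamma>) \<psi> \<sigma> \<tau>"
    using le P unfolding subst_le_def le_under_def P_def by blast
  from ssubst_mono_under[OF \<gamma> cl \<sigma> \<tau> this]
  have main: "le_under A \<gamma> (ssubst \<sigma> \<psi>) (ssubst \<tau> \<psi>)" .
  have "\<gamma> \<in> z" if z: "mcs A z" "acc y z" for z
    using mem z(1) Py acc_trans[OF y z(2)] by blast
  then show ?thesis using main unfolding le_at_def le_under_def by blast
qed

lemma mu_induct_at:
  assumes y: "mcs A y" and cl: "clean A (Mu r \<theta>)"
    and \<sigma>: "\<forall>p\<in>fv (Mu r \<theta>). over A (\<sigma> p)" and \<beta>: "over A \<beta>"
    and le: "le_at A y (ssubst (\<sigma>(r := \<beta>)) \<theta>) \<beta>"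
  shows "le_at A y (ssubst \<sigma> (Mu r \<theta>)) \<beta>"
proof -
  have ov: "over A (ssubst (\<sigma>(r := \<beta>)) \<theta>)" by (rule over_unfold[OF cl \<sigma> \<beta>])
  have "definable A (\<lambda>z. ssubst (\<sigma>(r := \<beta>)) \<theta> \<in> z \<longrightarrow> \<beta> \<in> z)"
    by (intro definable_imp definable_mem ov \<beta>)
  then obtain \<gamma> where \<gamma>: "over A \<gamma>" "\<forall>x. mcs A x \<longrightarrow> \<gamma> \<in> x \<longrightarrow> Box \<gamma> \<in> x"
    and mem: "\<forall>x. mcs A x \<longrightarrow> (\<gamma> \<in> x \<longleftrightarrow>
      (\<forall>z. mcs A z \<longrightarrow> acc x z \<longrightarrow> ssubst (\<sigma>(r := \<beta>)) \<theta> \<in> z \<longrightarrow> \<beta> \<in> z))"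
    by (rule definable_upward)
  let ?\<beta> = "\<gamma> \<^bold>\<longrightarrow> \<beta>"
  have ov': "over A ?\<beta>" using \<gamma>(1) \<beta> by simp
  have ov'': "over A (ssubst (\<sigma>(r := ?\<beta>)) \<theta>)" by (rule over_unfold[OF cl \<sigma> ov'])
  have step: "?\<beta> \<in> x" if x: "mcs A x" "ssubst (\<sigma>(r := ?\<beta>)) \<theta> \<in> x" for x
  proof (subst mcs_Imp[OF x(1) \<gamma>(1) \<beta>], rule impI)
    assume "\<gamma> \<in> x"
    then have "Box \<gamma> \<in> x" using \<gamma>(2) x(1) by blast
    \<comment> \<open>Everything above \<open>x\<close> contains \<open>\<gamma>\<close>, so the
      invariant implies \<open>\<beta>\<close> there; monotonicity then passes from the body at
      \<open>?\<beta>\<close> to the body at \<open>\<beta>\<close>, where \<open>\<gamma>\<close>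
      supplies the local premise.\<close>
    then have "le_at A x ?\<beta> \<beta>" using mcs_MP unfolding le_at_def acc_def by blast
    then have "subst_le (le_at A x) \<theta> (\<sigma>(r := ?\<beta>)) (\<sigma>(r := \<beta>))"
      using cl unfolding subst_le_def by (simp add: le_at_def)
    moreover have "clean A \<theta>" using cl by simp
    ultimately have "le_at A x (ssubst (\<sigma>(r := ?\<beta>)) \<theta>) (ssubst (\<sigma>(r := \<beta>)) \<theta>)"
      using ssubst_mono_at[of A x \<theta> "\<sigma>(r := ?\<beta>)" "\<sigma>(r := \<beta>)"] x(1) over_upd[OF \<sigma> ov']
        over_upd[OF \<sigma> \<beta>] by blast
    then have "ssubst (\<sigma>(r := \<beta>)) \<theta> \<in> x"
      using x acc_refl unfolding le_at_def by blast
    then show "\<beta> \<in> x" using mem \<open>\<gamma> \<in> x\<close> x(1) acc_refl by blast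
  qed
  have "derivable (ssubst (\<sigma>(r := ?\<beta>)) \<theta> \<^bold>\<longrightarrow> ?\<beta>)"
    by (rule iffD2[OF derivable_iff_mcs])
      (use step ov' ov'' mcs_Imp[OF _ ov'' ov'] over_simps(4) in blast)+
  from derivable_induct[OF cl \<sigma> ov' this]
  have "derivable (ssubst \<sigma> (Mu r \<theta>) \<^bold>\<longrightarrow> ?\<beta>)" .
  moreover have "over A (ssubst \<sigma> (Mu r \<theta>) \<^bold>\<longrightarrow> ?\<beta>)"
    using over_ssubst[OF cl \<sigma>] ov' by simp
  ultimately have "?\<beta> \<in> x" if "mcs A x" "ssubst \<sigma> (Mu r \<theta>) \<in> x" for x
    using that mcs_MP mcs_derivable by blast
  moreover have "\<gamma> \<in> z" if z: "mcs A z" "acc y z" for z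
    using mem z(1) le acc_trans[OF y z(2)] unfolding le_at_def by blast
  ultimately show ?thesis unfolding le_at_def using mcs_MP by blast
qed

section \<open>Truth lemma for a cluster\<close>

text \<open>The Fischer-Ladner closure, given by recursion on subformulas with an environment for
  the fixed point variables, so that finiteness is immediate.\<close>

primrec closure :: "('v \<Rightarrow> 'v fm) \<Rightarrow> 'v fm \<Rightarrow> 'v fm set" where
  "closure \<sigma> (Atom p) = {\<sigma> p}"
| "closure \<sigma> Top = {Top}"
| "closure \<sigma> (Neg \<phi>) = insert (ssubst \<sigma> (Neg \<phi>)) (closure \<sigma> \<phi>)"
| "closure \<sigma> (Conj \<phi> \<psi>) = insert (ssubst \<sigma> (Conj \<phi> \<psi>)) (closure \<sigma> \<phi> \<union> closure \<sigma> \<psi>)"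
| "closure \<sigma> (Box \<phi>) = insert (ssubst \<sigma> (Box \<phi>)) (closure \<sigma> \<phi>)"
| "closure \<sigma> (Mu r \<phi>) =
     insert (ssubst \<sigma> (Mu r \<phi>)) (closure (\<sigma>(r := ssubst \<sigma> (Mu r \<phi>))) \<phi>)"

lemma finite_closure: "finite (closure \<sigma> \<psi>)"
  by (induction \<psi> arbitrary: \<sigma>) simp_all

lemma ssubst_in_closure: "ssubst \<sigma> \<psi> \<in> closure \<sigma> \<psi>"
  by (cases \<psi>) simp_all

lemma fv_in_closure: "p \<in> fv \<psi> \<Longrightarrow> \<sigma> p \<in> closure \<sigma> \<psi>"
proof (induction \<psi> arbitrary: \<sigma>)
  case (Mu r \<theta>)
  have "(\<sigma>(r := ssubst \<sigma> (Mu r \<theta>))) p \<in> closure (\<sigma>(r := ssubst \<sigma> (Mu r \<theta>))) \<theta>"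
    using Mu.prems by (intro Mu.IH) simp
  moreover have "(\<sigma>(r := ssubst \<sigma> (Mu r \<theta>))) p = \<sigma> p" using Mu.prems by simp
  ultimately show ?case by (simp only: closure.simps insertI2)
qed auto

lemma over_closure:
  "clean A \<psi> \<Longrightarrow> \<forall>p\<in>fv \<psi>. over A (\<sigma> p) \<Longrightarrow> \<chi> \<in> closure \<sigma> \<psi> \<Longrightarrow> over A \<chi>"
proof (induction \<psi> arbitrary: \<sigma>)
  case (Mu r \<theta>)
  have ov: "over A (ssubst \<sigma> (Mu r \<theta>))" by (rule over_ssubst[OF Mu.prems(1,2)])
  have "clean A \<theta>" using Mu.prems(1) by simp
  from Mu.IH[OF this over_upd[OF Mu.prems(2) ov]] ov Mu.prems(3) show ?case
    unfolding closure.simps by blast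
qed (auto simp: over_ssubst)

text \<open>\<open>K\<close> says which sets above \<open>y\<close> belong to the cluster,
  \<open>T\<close> and \<open>T'\<close> are the types found inside and outside \<open>K\<close>,
  \<open>c t\<close> is the world for \<open>t\<close>, and \<open>Up\<close> is the part of the
  model above the cluster. Worlds of \<open>Up\<close> are tied to maximal consistent sets only
  through their types, which is all that \<open>Box\<close> can detect for formulas in
  \<open>\<Sigma>\<close>. A type may occur in both \<open>T\<close> and \<open>T'\<close>.\<close>

locale cluster =
  fixes A :: "'v set" and \<Sigma> :: "'v fm set" and y :: "'v fm set" and K :: "'v fm set \<Rightarrow> bool"
    and W :: "'w set" and R :: "('w \<times> 'w) set" and h :: "'v \<Rightarrow> 'w set"
    and c :: "'v fm set \<Rightarrow> 'w" and Up :: "'w set" and T T' :: "'v fm set set"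
  assumes y: "mcs A y"
    and \<Sigma>: "finite \<Sigma>" "\<And>\<chi>. \<chi> \<in> \<Sigma> \<Longrightarrow> over A \<chi>"
    and K: "definable A K"
    and not_K: "\<And>z z'. mcs A z \<Longrightarrow> acc y z \<Longrightarrow> mcs A z' \<Longrightarrow> acc z z' \<Longrightarrow> \<not> K z \<Longrightarrow> \<not> K z'"
    and K_type: "\<And>z. mcs A z \<Longrightarrow> acc y z \<Longrightarrow> K z \<Longrightarrow> z \<inter> \<Sigma> \<in> T"
    and not_K_type: "\<And>z. mcs A z \<Longrightarrow> acc y z \<Longrightarrow> \<not> K z \<Longrightarrow> z \<inter> \<Sigma> \<in> T'"
    and K_sees_K: "\<And>z t. mcs A z \<Longrightarrow> acc y z \<Longrightarrow> K z \<Longrightarrow> t \<in> T \<Longrightarrow>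
      \<exists>z'. mcs A z' \<and> acc z z' \<and> K z' \<and> z' \<inter> \<Sigma> = t"
    and K_sees_not_K: "\<And>z t. mcs A z \<Longrightarrow> acc y z \<Longrightarrow> K z \<Longrightarrow> t \<in> T' \<Longrightarrow>
      \<exists>z'. mcs A z' \<and> acc z z' \<and> \<not> K z' \<and> z' \<inter> \<Sigma> = t"
    and R: "R \<subseteq> W \<times> W"
    and W: "W = c ` T \<union> Up" "inj_on c T" "c ` T \<inter> Up = {}"
    and R_cluster: "\<And>t w. t \<in> T \<Longrightarrow> (c t, w) \<in> R \<longleftrightarrow> w \<in> W"
    and R_Up: "\<And>v w. (v, w) \<in> R \<Longrightarrow> v \<in> Up \<Longrightarrow> w \<in> Up"
    and Up: "(\<lambda>m. {\<chi> \<in> \<Sigma>. sat \<chi> W R h m}) ` Up = T'"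
    and h: "\<And>p t. t \<in> T \<Longrightarrow> Atom p \<in> \<Sigma> \<Longrightarrow> c t \<in> h p \<longleftrightarrow> Atom p \<in> t"
begin

text \<open>
  \<open>\<sigma>\<close> interprets the fixed point variables by the fixed points themselves, \<open>\<tau>\<close> and \<open>V\<close> by
  approximations of them that agree with \<open>\<sigma>\<close> outside the cluster.
\<close>

definition env :: "'v fm \<Rightarrow> ('v \<Rightarrow> 'v fm) \<Rightarrow> ('v \<Rightarrow> 'v fm) \<Rightarrow> ('v \<Rightarrow> 'w set) \<Rightarrow> bool" where
  "env \<psi> \<sigma> \<tau> V \<longleftrightarrow> (\<forall>p\<in>fv \<psi>. over A (\<sigma> p)) \<and> (\<forall>p\<in>fv \<psi>. over A (\<tau> p)) \<and>
    (\<forall>p\<in>fv \<psi>. \<forall>z. mcs A z \<longrightarrow> acc y z \<longrightarrow> \<not> K z \<longrightarrow> (\<sigma> p \<in> z \<longleftrightarrow> \<tau> p \<in> z)) \<and>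
    (\<forall>p\<in>fv \<psi>. \<forall>z. mcs A z \<longrightarrow> acc y z \<longrightarrow> K z \<longrightarrow> (\<tau> p \<in> z \<longleftrightarrow> c (z \<inter> \<Sigma>) \<in> V p)) \<and>
    (\<forall>p\<in>fv \<psi>. \<forall>m\<in>Up. m \<in> V p \<longleftrightarrow> sat (\<sigma> p) W R h m)"

lemma env_fv: "env \<phi> \<sigma> \<tau> V \<Longrightarrow> fv \<psi> \<subseteq> fv \<phi> \<Longrightarrow> env \<psi> \<sigma> \<tau> V"
  unfolding env_def by blast

lemma env_upd:
  assumes "env (Mu r \<theta>) \<sigma> \<tau> V" "over A \<rho>" "over A \<beta>"
    and "\<forall>z. mcs A z \<longrightarrow> acc y z \<longrightarrow> \<not> K z \<longrightarrow> (\<rho> \<in> z \<longleftrightarrow> \<beta> \<in> z)"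
    and "\<forall>z. mcs A z \<longrightarrow> acc y z \<longrightarrow> K z \<longrightarrow> (\<beta> \<in> z \<longleftrightarrow> c (z \<inter> \<Sigma>) \<in> S)"
    and "\<forall>m\<in>Up. m \<in> S \<longleftrightarrow> sat \<rho> W R h m"
  shows "env \<theta> (\<sigma>(r := \<rho>)) (\<tau>(r := \<beta>)) (V(r := S))"
  using assms unfolding env_def by simp

text \<open>Leaving \<open>K\<close> is irrevocable, so above \<open>z\<close> the substitutions
  agree everywhere, and monotonicity applies in both directions.\<close>

lemma not_K_cong:
  assumes env: "env \<psi> \<sigma> \<tau> V" and cl: "clean A \<psi>" and z: "mcs A z" "acc y z" "\<not> K z"
  shows "ssubst \<sigma> \<psi> \<in> z \<longleftrightarrow> ssubst \<tau> \<psi> \<in> z"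
proof -
  have ov: "\<forall>p\<in>fv \<psi>. over A (\<sigma> p)" "\<forall>p\<in>fv \<psi>. over A (\<tau> p)"
    using env by (simp_all add: env_def)
  have "\<sigma> p \<in> z' \<longleftrightarrow> \<tau> p \<in> z'" if "p \<in> fv \<psi>" "mcs A z'" "acc z z'" for p z'
    using env that acc_trans[OF y z(2) that(3)] not_K[OF z(1,2) that(2,3) z(3)]
    unfolding env_def by blast
  then have "subst_le (le_at A z) \<psi> \<sigma> \<tau>" "subst_le (le_at A z) \<psi> \<tau> \<sigma>"
    unfolding subst_le_def le_at_def by blast+
  then have "le_at A z (ssubst \<sigma> \<psi>) (ssubst \<tau> \<psi>)" "le_at A z (ssubst \<tau> \<psi>) (ssubst \<sigma> \<psi>)"
    using ssubst_mono_at[OF z(1) cl] ov by blast+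
  then show ?thesis using z(1) acc_refl unfolding le_at_def by blast
qed

text \<open>\<open>Up\<close> is upward closed, so only the values of \<open>V\<close> on
  \<open>Up\<close> count, and there \<open>V p\<close> is the truth set of
  \<open>\<sigma> p\<close>.\<close>

lemma Up_cong:
  assumes env: "env \<psi> \<sigma> \<tau> V" and cl: "clean A \<psi>" and m: "m \<in> Up"
  shows "sat \<psi> W R V m \<longleftrightarrow> sat (ssubst \<sigma> \<psi>) W R h m"
proof -
  let ?V = "\<lambda>p. {v. sat (\<sigma> p) W R h v}"
  have "m \<in> W" using m W by blast
  have "capture_free \<sigma> \<psi>"
    using clean_ssubst[OF cl, of \<sigma>] env by (simp add: env_def)
  then have "sat (ssubst \<sigma> \<psi>) W R h m = sat \<psi> W R ?V m"
    using \<open>m \<in> W\<close> by (intro sat_ssubst[OF R]) simp_all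
  moreover have "sat \<psi> W R V m = sat \<psi> W R ?V m"
  proof (rule sat_local[OF R, of Up])
    show "V p \<inter> Up = ?V p \<inter> Up" if "p \<in> fv \<psi>" for p
      using env that unfolding env_def by blast
  qed (use W R_Up cl m in \<open>auto simp: clean_def\<close>)
  ultimately show ?thesis by simp
qed

text \<open>Approximations \<open>\<tau>\<close>, \<open>V\<close> are allowed because the
  \<open>Mu\<close> case evaluates the body at values of \<open>r\<close> other than the fixed
  point. Only the formulas built with \<open>\<sigma>\<close> are required to lie in
  \<open>\<Sigma>\<close>; outside \<open>K\<close>, \<open>not_K_cong\<close> leads from
  \<open>\<tau>\<close> back to them.\<close>

lemma truth:
  "clean A \<psi> \<Longrightarrow> closure \<sigma> \<psi> \<subseteq> \<Sigma> \<Longrightarrow> env \<psi> \<sigma> \<tau> V \<Longrightarrow>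
    mcs A k \<Longrightarrow> acc y k \<Longrightarrow> K k \<Longrightarrow> ssubst \<tau> \<psi> \<in> k \<longleftrightarrow> sat \<psi> W R V (c (k \<inter> \<Sigma>))"
proof (induction \<psi> arbitrary: \<sigma> \<tau> V k)
  case (Atom p)
  then show ?case by (simp add: env_def)
next
  case Top
  then show ?case using mcs_Top by simp
next
  case (Neg \<psi>)
  have env: "env \<psi> \<sigma> \<tau> V" using env_fv[OF Neg.prems(3)] by simp
  then have "over A (ssubst \<tau> \<psi>)" using Neg.prems(1) by (simp add: env_def over_ssubst)
  moreover have "ssubst \<tau> \<psi> \<in> k \<longleftrightarrow> sat \<psi> W R V (c (k \<inter> \<Sigma>))"
    using Neg.IH[OF _ _ env Neg.prems(4-6)] Neg.prems(1,2) by simp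
  ultimately show ?case using mcs_Neg[OF Neg.prems(4)] by simp
next
  case (Conj \<phi> \<psi>)
  have env: "env \<phi> \<sigma> \<tau> V" "env \<psi> \<sigma> \<tau> V" using env_fv[OF Conj.prems(3)] by simp_all
  then have "over A (ssubst \<tau> \<phi>)" "over A (ssubst \<tau> \<psi>)"
    using Conj.prems(1) by (simp_all add: env_def over_ssubst)
  moreover have "ssubst \<tau> \<phi> \<in> k \<longleftrightarrow> sat \<phi> W R V (c (k \<inter> \<Sigma>))"
    using Conj.IH(1)[OF _ _ env(1) Conj.prems(4-6)] Conj.prems(1,2) by simp
  moreover have "ssubst \<tau> \<psi> \<in> k \<longleftrightarrow> sat \<psi> W R V (c (k \<inter> \<Sigma>))"
    using Conj.IH(2)[OF _ _ env(2) Conj.prems(4-6)] Conj.prems(1,2) by simp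
  ultimately show ?case using mcs_Conj[OF Conj.prems(4)] by simp
next
  case (Box \<psi>)
  have env: "env \<psi> \<sigma> \<tau> V" using env_fv[OF Box.prems(3)] by simp
  have cl: "clean A \<psi>" "closure \<sigma> \<psi> \<subseteq> \<Sigma>" using Box.prems(1,2) by simp_all
  have IH: "ssubst \<tau> \<psi> \<in> z \<longleftrightarrow> sat \<psi> W R V (c (z \<inter> \<Sigma>))" if "mcs A z" "acc y z" "K z" for z
    by (rule Box.IH[OF cl env that])
  have in\<Sigma>: "ssubst \<sigma> \<psi> \<in> \<Sigma>" using cl(2) ssubst_in_closure by blast
  have ov: "over A (ssubst \<tau> \<psi>)" using cl env by (simp add: env_def over_ssubst)
  have up: "acc y z" if "acc k z" for z using acc_trans[OF y Box.prems(5) that] .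
  have kT: "k \<inter> \<Sigma> \<in> T" by (rule K_type[OF Box.prems(4-6)])
  have "(\<forall>z. mcs A z \<longrightarrow> acc k z \<longrightarrow> ssubst \<tau> \<psi> \<in> z) \<longleftrightarrow> (\<forall>w\<in>W. sat \<psi> W R V w)"
  proof
    assume all: "\<forall>z. mcs A z \<longrightarrow> acc k z \<longrightarrow> ssubst \<tau> \<psi> \<in> z"
    show "\<forall>w\<in>W. sat \<psi> W R V w"
    proof
      fix w assume "w \<in> W"
      then consider t where "t \<in> T" "w = c t" | "w \<in> Up" using W(1) by blast
      then show "sat \<psi> W R V w"
      proof cases
        case 1
        obtain z where z: "mcs A z" "acc k z" "K z" "z \<inter> \<Sigma> = t"
          using K_sees_K[OF Box.prems(4-6) 1(1)] by blast
        then show ?thesis using all IH[OF z(1) up[OF z(2)] z(3)] 1(2) by blast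
      next
        case 2
        \<comment> \<open>The world \<open>w\<close> and a set outside \<open>K\<close> share a
          type, so the argument goes through \<open>ssubst \<sigma> \<psi>\<close>, which is in
          \<open>\<Sigma>\<close>: from \<open>\<tau>\<close> to \<open>\<sigma>\<close> in the set,
          across the type, and then to \<open>V\<close> by \<open>Up_cong\<close>.\<close>
        then have "{\<chi> \<in> \<Sigma>. sat \<chi> W R h w} \<in> T'" using Up by blast
        then obtain z where z: "mcs A z" "acc k z" "\<not> K z" "z \<inter> \<Sigma> = {\<chi> \<in> \<Sigma>. sat \<chi> W R h w}"
          using K_sees_not_K[OF Box.prems(4-6)] by blast
        then have "ssubst \<sigma> \<psi> \<in> z"
          using all not_K_cong[OF env cl(1) z(1) up[OF z(2)] z(3)] by blast
        then have "sat (ssubst \<sigma> \<psi>) W R h w" using z(4) in\<Sigma> by blast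
        then show ?thesis using Up_cong[OF env cl(1) 2] by blast
      qed
    qed
  next
    assume all: "\<forall>w\<in>W. sat \<psi> W R V w"
    show "\<forall>z. mcs A z \<longrightarrow> acc k z \<longrightarrow> ssubst \<tau> \<psi> \<in> z"
    proof (intro allI impI)
      fix z assume z: "mcs A z" "acc k z"
      show "ssubst \<tau> \<psi> \<in> z"
      proof (cases "K z")
        case True
        then have "c (z \<inter> \<Sigma>) \<in> W" using K_type[OF z(1) up[OF z(2)]] W(1) by blast
        then show ?thesis using all IH[OF z(1) up[OF z(2)] True] by blast
      next
        case False
        have "z \<inter> \<Sigma> \<in> T'" by (rule not_K_type[OF z(1) up[OF z(2)] False])
        then obtain m where m: "m \<in> Up" "z \<inter> \<Sigma> = {\<chi> \<in> \<Sigma>. sat \<chi> W R h m}"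
          using Up by blast
        then have "sat (ssubst \<sigma> \<psi>) W R h m"
          using all Up_cong[OF env cl(1) m(1)] W(1) by blast
        then have "ssubst \<sigma> \<psi> \<in> z" using m(2) in\<Sigma> by blast
        then show ?thesis using not_K_cong[OF env cl(1) z(1) up[OF z(2)] False] by blast
      qed
    qed
  qed
  then show ?case
    using mcs_Box[OF Box.prems(4) ov] R_cluster[OF kT] by (simp add: Ball_def)
next
  case (Mu r \<theta>)
  let ?\<rho> = "ssubst \<sigma> (Mu r \<theta>)" and ?\<mu> = "ssubst \<tau> (Mu r \<theta>)"
  let ?F = "\<lambda>S. {v \<in> W. sat \<theta> W R (V(r := S)) v}"
  define L where "L = lfp ?F"
  have cl: "clean A \<theta>" "positive r \<theta>" "is_fm \<theta>" using Mu.prems(1) by (simp_all add: clean_def)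
  have L: "L = ?F L" unfolding L_def by (rule sat_Mu_unfold[OF cl(3,2)])
  have \<sigma>: "\<forall>p\<in>fv (Mu r \<theta>). over A (\<sigma> p)" and \<tau>: "\<forall>p\<in>fv (Mu r \<theta>). over A (\<tau> p)"
    using Mu.prems(3) unfolding env_def by blast+
  have ov: "over A ?\<rho>" "over A ?\<mu>"
    using over_ssubst[OF Mu.prems(1)] \<sigma> \<tau> by blast+
  have in\<Sigma>: "closure (\<sigma>(r := ?\<rho>)) \<theta> \<subseteq> \<Sigma>" using Mu.prems(2) unfolding closure.simps by blast
  have L_Up: "m \<in> L \<longleftrightarrow> sat ?\<rho> W R h m" if "m \<in> Up" for m
    using Up_cong[OF Mu.prems(3,1) that] unfolding L_def sat.simps(6) .
  \<comment> \<open>Any set \<open>D\<close> of types gives an approximant: \<open>D\<close> inside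
    \<open>K\<close>, the fixed point itself outside.\<close>
  have approx: "\<exists>\<beta>. over A \<beta> \<and> (\<forall>z. mcs A z \<longrightarrow> (\<beta> \<in> z \<longleftrightarrow> (if K z then z \<inter> \<Sigma> \<in> D else ?\<rho> \<in> z)))" for D
  proof -
    have "definable A (\<lambda>z. (K z \<longrightarrow> z \<inter> \<Sigma> \<in> D) \<and> (\<not> K z \<longrightarrow> ?\<rho> \<in> z))"
      by (intro definable_conj definable_imp definable_not definable_mem definable_type K \<Sigma> ov)
    then show ?thesis unfolding definable_def if_bool_eq_conj .
  qed
  have IH: "ssubst (\<tau>(r := \<beta>)) \<theta> \<in> z \<longleftrightarrow> sat \<theta> W R (V(r := S)) (c (z \<inter> \<Sigma>))"
    if "env \<theta> (\<sigma>(r := ?\<rho>)) (\<tau>(r := \<beta>)) (V(r := S))" "mcs A z" "acc y z" "K z" for \<beta> S z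
    by (rule Mu.IH[OF cl(1) in\<Sigma> that])
  have kT: "k \<inter> \<Sigma> \<in> T" by (rule K_type[OF Mu.prems(4-6)])
  have "?\<mu> \<in> k \<longleftrightarrow> c (k \<inter> \<Sigma>) \<in> L"
  proof
    assume k: "?\<mu> \<in> k"
    \<comment> \<open>The formula for the model's fixed point \<open>L\<close>. It is prefixed above
      \<open>y\<close>: inside \<open>K\<close> by the induction hypothesis and
      \<open>L = ?F L\<close>, outside by \<open>Fix\<close>. Local induction then puts
      \<open>?\<mu>\<close> below it.\<close>
    obtain \<beta> where \<beta>: "over A \<beta>"
        "\<forall>z. mcs A z \<longrightarrow> (\<beta> \<in> z \<longleftrightarrow> (if K z then z \<inter> \<Sigma> \<in> {t. c t \<in> L} else ?\<rho> \<in> z))"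
      using approx by blast
    have env: "env \<theta> (\<sigma>(r := ?\<rho>)) (\<tau>(r := \<beta>)) (V(r := L))"
      by (rule env_upd[OF Mu.prems(3) ov(1) \<beta>(1)]) (use \<beta>(2) L_Up in simp_all)
    have "le_at A y (ssubst (\<tau>(r := \<beta>)) \<theta>) \<beta>"
      unfolding le_at_def
    proof (intro allI impI)
      fix z assume z: "mcs A z" "acc y z" "ssubst (\<tau>(r := \<beta>)) \<theta> \<in> z"
      show "\<beta> \<in> z"
      proof (cases "K z")
        case True
        then have "sat \<theta> W R (V(r := L)) (c (z \<inter> \<Sigma>))" using IH[OF env z(1,2) True] z(3) by blast
        moreover have "c (z \<inter> \<Sigma>) \<in> W" using K_type[OF z(1,2) True] W(1) by blast
        ultimately have "c (z \<inter> \<Sigma>) \<in> L" by (subst L) blast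
        then show ?thesis using \<beta>(2) z(1) True by simp
      next
        case False
        then have "ssubst (\<sigma>(r := ?\<rho>)) \<theta> \<in> z"
          using not_K_cong[OF env cl(1) z(1,2) False] z(3) by blast
        then have "?\<rho> \<in> z" by (rule mcs_unfold[OF z(1) Mu.prems(1) \<sigma>])
        then show ?thesis using \<beta>(2) z(1) False by (simp only: if_False)
      qed
    qed
    then have "le_at A y ?\<mu> \<beta>" by (rule mu_induct_at[OF y Mu.prems(1) \<tau> \<beta>(1)])
    then have "\<beta> \<in> k" using k Mu.prems(4,5) unfolding le_at_def by blast
    then show "c (k \<inter> \<Sigma>) \<in> L" using \<beta>(2) Mu.prems(4,6) by simp
  next
    assume k: "c (k \<inter> \<Sigma>) \<in> L"
    \<comment> \<open>Membership of \<open>?\<mu>\<close> in \<open>z\<close> is not yet known to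
      depend on the type alone, so all representatives in \<open>K\<close> are required to contain
      it. This puts the resulting approximant below \<open>?\<mu>\<close>.\<close>
    define N where "N = {t \<in> T. \<forall>z. mcs A z \<longrightarrow> acc y z \<longrightarrow> K z \<longrightarrow> z \<inter> \<Sigma> = t \<longrightarrow> ?\<mu> \<in> z}"
    \<comment> \<open>Agreement with \<open>L\<close> on \<open>Up\<close> is what
      \<open>env\<close> demands of a value for \<open>r\<close>.\<close>
    define N' where "N' = c ` N \<union> (L \<inter> Up)"
    have N': "c t \<in> N' \<longleftrightarrow> t \<in> N" if "t \<in> T" for t
    proof
      assume "c t \<in> N'"
      then have "c t \<in> c ` N" using that W(3) unfolding N'_def by blast
      then show "t \<in> N" using that W(2) unfolding N_def by (auto dest: inj_onD)
    qed (simp add: N'_def)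
    have N'_Up: "m \<in> N' \<longleftrightarrow> m \<in> L" if "m \<in> Up" for m
      using that W(3) unfolding N'_def N_def by blast
    obtain \<beta> where \<beta>: "over A \<beta>"
        "\<forall>z. mcs A z \<longrightarrow> (\<beta> \<in> z \<longleftrightarrow> (if K z then z \<inter> \<Sigma> \<in> N else ?\<rho> \<in> z))"
      using approx by blast
    have env: "env \<theta> (\<sigma>(r := ?\<rho>)) (\<tau>(r := \<beta>)) (V(r := N'))"
      by (rule env_upd[OF Mu.prems(3) ov(1) \<beta>(1)]) (use \<beta>(2) L_Up N' N'_Up K_type in simp_all)
    have "?F N' \<subseteq> N'"
    proof
      fix v assume v: "v \<in> ?F N'"
      then consider t where "t \<in> T" "v = c t" | "v \<in> Up" using W(1) by blast
      then show "v \<in> N'"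
      proof cases
        case 1
        have "?\<mu> \<in> z" if z: "mcs A z" "acc y z" "K z" "z \<inter> \<Sigma> = t" for z
        proof -
          \<comment> \<open>Once \<open>\<beta>\<close> is below \<open>?\<mu>\<close>, a set
            containing the body at \<open>\<beta>\<close> contains the body at
            \<open>?\<mu>\<close>, and so \<open>?\<mu>\<close> by \<open>Fix\<close>.\<close>
          have "le_at A y \<beta> ?\<mu>"
            unfolding le_at_def
          proof (intro allI impI)
            fix z assume z: "mcs A z" "acc y z" "\<beta> \<in> z"
            show "?\<mu> \<in> z"
            proof (cases "K z")
              case True
              then have "z \<inter> \<Sigma> \<in> N" using \<beta>(2) z by simp
              then show ?thesis using z True unfolding N_def by blast
            next
              case False
              then have "?\<rho> \<in> z" using \<beta>(2) z(1,3) by (simp only: if_False)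
              then show ?thesis using not_K_cong[OF Mu.prems(3,1) z(1,2) False] by blast
            qed
          qed
          then have "subst_le (le_at A y) \<theta> (\<tau>(r := \<beta>)) (\<tau>(r := ?\<mu>))"
            using cl(2) unfolding subst_le_def by (simp add: le_at_def)
          then have "le_at A y (ssubst (\<tau>(r := \<beta>)) \<theta>) (ssubst (\<tau>(r := ?\<mu>)) \<theta>)"
            using ssubst_mono_at[of A y \<theta> "\<tau>(r := \<beta>)" "\<tau>(r := ?\<mu>)"] y cl(1) over_upd[OF \<tau> \<beta>(1)]
              over_upd[OF \<tau> ov(2)] by blast
          moreover have "ssubst (\<tau>(r := \<beta>)) \<theta> \<in> z" using IH[OF env z(1-3)] v 1(2) z(4) by blast
          ultimately have "ssubst (\<tau>(r := ?\<mu>)) \<theta> \<in> z" using z unfolding le_at_def by blast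
          then show ?thesis by (rule mcs_unfold[OF z(1) Mu.prems(1) \<tau>])
        qed
        then have "t \<in> N" using 1(1) unfolding N_def by blast
        then show ?thesis using 1(2) unfolding N'_def by blast
      next
        case 2
        have "sat \<theta> W R (V(r := N')) v = sat \<theta> W R (V(r := L)) v"
        proof (rule sat_local[OF R, of Up])
          show "(V(r := N')) p \<inter> Up = (V(r := L)) p \<inter> Up" for p
            using N'_Up by (cases "p = r") auto
        qed (use W(1) R_Up cl 2 in auto)
        then have "v \<in> ?F L" using v by blast
        then have "v \<in> L" using L by blast
        then show ?thesis using N'_Up[OF 2] by blast
      qed
    qed
    then have "L \<subseteq> N'" unfolding L_def by (rule lfp_lowerbound)
    then have "k \<inter> \<Sigma> \<in> N" using k N'[OF kT] by blast
    then show "?\<mu> \<in> k" using Mu.prems(4-6) unfolding N_def by blast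
  qed
  then show ?case unfolding L_def sat.simps(6) .
qed

definition agree :: "'v fm \<Rightarrow> bool" where
  "agree \<chi> \<longleftrightarrow> (\<forall>z. mcs A z \<longrightarrow> acc y z \<longrightarrow> K z \<longrightarrow> (\<chi> \<in> z \<longleftrightarrow> sat \<chi> W R h (c (z \<inter> \<Sigma>))))"

text \<open>The truth lemma without approximation: \<open>\<tau>\<close> is \<open>\<sigma>\<close>,
  and \<open>V p\<close> is the truth set of \<open>\<sigma> p\<close>.\<close>

lemma agree_ssubst:
  assumes "clean A \<psi>" "closure \<sigma> \<psi> \<subseteq> \<Sigma>" "\<forall>p\<in>fv \<psi>. over A (\<sigma> p)" "\<forall>p\<in>fv \<psi>. agree (\<sigma> p)"
  shows "agree (ssubst \<sigma> \<psi>)"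
  unfolding agree_def
proof (intro allI impI)
  fix z assume z: "mcs A z" "acc y z" "K z"
  let ?V = "\<lambda>p. {v. sat (\<sigma> p) W R h v}"
  have "env \<psi> \<sigma> \<sigma> ?V" using assms(3,4) unfolding env_def agree_def by simp
  from truth[OF assms(1,2) this z]
  have "ssubst \<sigma> \<psi> \<in> z \<longleftrightarrow> sat \<psi> W R ?V (c (z \<inter> \<Sigma>))" .
  moreover have "sat (ssubst \<sigma> \<psi>) W R h (c (z \<inter> \<Sigma>)) = sat \<psi> W R ?V (c (z \<inter> \<Sigma>))"
    using clean_ssubst[OF assms(1), of \<sigma>] assms(3) K_type[OF z] W(1)
    by (intro sat_ssubst[OF R]) simp_all
  ultimately show "ssubst \<sigma> \<psi> \<in> z \<longleftrightarrow> sat (ssubst \<sigma> \<psi>) W R h (c (z \<inter> \<Sigma>))" by simp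
qed

text \<open>Passing under a binder puts the fixed point into the environment, and
  \<open>agree_ssubst\<close> has just shown agreement for it.\<close>

lemma agree_closure:
  "clean A \<psi> \<Longrightarrow> closure \<sigma> \<psi> \<subseteq> \<Sigma> \<Longrightarrow> \<forall>p\<in>fv \<psi>. over A (\<sigma> p) \<Longrightarrow> \<forall>p\<in>fv \<psi>. agree (\<sigma> p) \<Longrightarrow>
    \<chi> \<in> closure \<sigma> \<psi> \<Longrightarrow> agree \<chi>"
proof (induction \<psi> arbitrary: \<sigma>)
  case (Neg \<psi>)
  then show ?case using agree_ssubst[OF Neg.prems(1-4)] by auto
next
  case (Conj \<phi> \<psi>)
  then show ?case using agree_ssubst[OF Conj.prems(1-4)] by auto
next
  case (Box \<psi>)
  then show ?case using agree_ssubst[OF Box.prems(1-4)] by auto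
next
  case (Mu r \<theta>)
  let ?\<rho> = "ssubst \<sigma> (Mu r \<theta>)"
  have \<rho>: "agree ?\<rho>" by (rule agree_ssubst[OF Mu.prems(1-4)])
  have cl: "clean A \<theta>" "closure (\<sigma>(r := ?\<rho>)) \<theta> \<subseteq> \<Sigma>"
    using Mu.prems(1,2) unfolding closure.simps clean_simps by blast+
  have "\<forall>p\<in>fv \<theta>. agree ((\<sigma>(r := ?\<rho>)) p)" using Mu.prems(4) \<rho> by simp
  from Mu.IH[OF cl over_upd[OF Mu.prems(3) over_ssubst[OF Mu.prems(1,3)]] this]
  show ?case using \<rho> Mu.prems(5) unfolding closure.simps by blast
qed (auto simp: agree_def mcs_Top)

end

section \<open>Finite models of maximal consistent sets\<close>

definition types :: "'v set \<Rightarrow> 'v fm set \<Rightarrow> 'v fm set \<Rightarrow> 'v fm set set" where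
  "types A \<Sigma> x = {z \<inter> \<Sigma> | z. mcs A z \<and> acc x z}"

text \<open>Lists as worlds let models be made disjoint by a prefix without changing the type of
  worlds. Excluding \<open>[]\<close> reserves the one-element lists for a cluster.\<close>

definition realizes :: "'v fm set \<Rightarrow> 'v fm set set \<Rightarrow>
    'b list set \<times> ('b list \<times> 'b list) set \<times> ('v \<Rightarrow> 'b list set) \<Rightarrow> bool" where
  "realizes \<Sigma> S M \<longleftrightarrow> (case M of (W, R, h) \<Rightarrow>
     finite W \<and> [] \<notin> W \<and> R \<subseteq> W \<times> W \<and> refl_on W R \<and> trans R \<and>
     (\<lambda>m. {\<chi> \<in> \<Sigma>. sat \<chi> W R h m}) ` W = S)"

lemma types_mono: "mcs A x \<Longrightarrow> acc x z \<Longrightarrow> types A \<Sigma> z \<subseteq> types A \<Sigma> x"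
  unfolding types_def using acc_trans by blast

lemma finite_types: "finite \<Sigma> \<Longrightarrow> finite (types A \<Sigma> x)"
  unfolding types_def by (rule finite_subset[of _ "Pow \<Sigma>"]) auto

text \<open>Seeing a type is a negated box over a definable property. If \<open>S\<close> has a
  member that is no subset of \<open>\<Sigma>\<close>, the property is constantly false.\<close>

lemma definable_types_superset:
  assumes "finite \<Sigma>" "\<And>\<chi>. \<chi> \<in> \<Sigma> \<Longrightarrow> over A \<chi>"
  shows "definable A (\<lambda>z. S \<subseteq> types A \<Sigma> z)"
proof (cases "S \<subseteq> Pow \<Sigma>")
  case True
  then have "finite S" using assms(1) by (simp add: finite_subset)
  have "definable A (\<lambda>z. \<forall>t\<in>S. \<not> (\<forall>z'. mcs A z' \<longrightarrow> acc z z' \<longrightarrow> \<not> z' \<inter> \<Sigma> \<in> {t}))"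
    by (intro definable_all definable_not definable_box definable_type assms \<open>finite S\<close>)
  moreover have "(\<lambda>z. \<forall>t\<in>S. \<not> (\<forall>z'. mcs A z' \<longrightarrow> acc z z' \<longrightarrow> \<not> z' \<inter> \<Sigma> \<in> {t})) =
      (\<lambda>z. S \<subseteq> types A \<Sigma> z)"
  proof
    fix z
    have "t \<in> types A \<Sigma> z \<longleftrightarrow> \<not> (\<forall>z'. mcs A z' \<longrightarrow> acc z z' \<longrightarrow> \<not> z' \<inter> \<Sigma> \<in> {t})" for t
      unfolding types_def by auto
    then show "(\<forall>t\<in>S. \<not> (\<forall>z'. mcs A z' \<longrightarrow> acc z z' \<longrightarrow> \<not> z' \<inter> \<Sigma> \<in> {t})) =
      (S \<subseteq> types A \<Sigma> z)"
      unfolding subset_iff Ball_def by simp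
  qed
  ultimately show ?thesis by simp
next
  case False
  moreover have "types A \<Sigma> z \<subseteq> Pow \<Sigma>" for z unfolding types_def by blast
  ultimately have "(\<lambda>z. S \<subseteq> types A \<Sigma> z) = (\<lambda>z. False)" by (meson subset_trans)
  then show ?thesis using definable_const by simp
qed

text \<open>
  The induction is on the number of types seen from \<open>x\<close>. Among the sets that see the same types as
  \<open>x\<close> take one, \<open>y\<close>, that is final: everything above it seeing the same types as \<open>x\<close> sees the
  same types inside and outside this class as \<open>y\<close> does. The types realized inside the class then
  form a bottom cluster below the models of the types outside, which see fewer types. The type of
  \<open>x\<close> itself need not recur in the cluster, but it is seen from \<open>y\<close> and hence realized somewhere.
\<close>

lemma ex_finite_model:
  assumes \<phi>: "over A \<phi>" and \<Sigma>_def: "\<Sigma> = closure Atom \<phi>"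
  shows "mcs A x \<Longrightarrow>
    \<exists>M :: 'v fm set list set \<times> _ \<times> ('v \<Rightarrow> _). realizes \<Sigma> (types A \<Sigma> x) M"
proof (induction "card (types A \<Sigma> x)" arbitrary: x rule: less_induct)
  case less
  note x = \<open>mcs A x\<close>
  have cl: "clean A \<phi>" and atoms: "\<forall>p\<in>fv \<phi>. over A (Atom p)"
    using \<phi> by (auto simp: over_def)
  have \<Sigma>: "finite \<Sigma>" "\<And>\<chi>. \<chi> \<in> \<Sigma> \<Longrightarrow> over A \<chi>"
    unfolding \<Sigma>_def by (rule finite_closure, rule over_closure[OF cl atoms])
  \<comment> \<open>For sets above \<open>x\<close> this inclusion amounts to equality, by
    \<open>types_mono\<close>.\<close>
  define K where "K = (\<lambda>z. types A \<Sigma> x \<subseteq> types A \<Sigma> z)"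
  define T where "T = (\<lambda>z. {u \<inter> \<Sigma> | u. mcs A u \<and> acc z u \<and> K u})"
  define T' where "T' = (\<lambda>z. {u \<inter> \<Sigma> | u. mcs A u \<and> acc z u \<and> \<not> K u})"
  have T_fin: "finite (T z)" "finite (T' z)" for z
    unfolding T_def T'_def by (rule finite_subset[of _ "Pow \<Sigma>"]; use \<Sigma>(1) in auto)+
  have T_mono: "T z \<subseteq> T y" "T' z \<subseteq> T' y" if "mcs A y" "acc y z" for y z
    using acc_trans[OF that] unfolding T_def T'_def by blast+
  have types_T: "types A \<Sigma> z = T z \<union> T' z" for z
    unfolding types_def T_def T'_def by blast
  have "mcs A x \<and> acc x x \<and> K x" using x acc_refl by (simp add: K_def)
  \<comment> \<open>Both \<open>T\<close> and \<open>T'\<close> shrink along \<open>acc\<close>, so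
    a set minimizing the sum of their sizes keeps both constant at all sets in \<open>K\<close>
    above it.\<close>
  from ex_has_least_nat[where m = "\<lambda>z. card (T z) + card (T' z)" and P = "\<lambda>y. mcs A y \<and> acc x y \<and> K y", OF this]
  obtain y where y: "mcs A y" "acc x y" "K y"
    and least: "\<And>z. mcs A z \<Longrightarrow> acc x z \<Longrightarrow> K z \<Longrightarrow>
      card (T y) + card (T' y) \<le> card (T z) + card (T' z)" by blast
  have types_y: "types A \<Sigma> y = types A \<Sigma> x"
    using types_mono[OF x y(2)] y(3) unfolding K_def by (rule subset_antisym)
  have final: "T z = T y" "T' z = T' y" if z: "mcs A z" "acc y z" "K z" for z
  proof -
    have "card (T z) \<le> card (T y)" "card (T' z) \<le> card (T' y)"
      using T_mono[OF y(1) z(2)] T_fin by (simp_all add: card_mono)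
    moreover have "card (T y) + card (T' y) \<le> card (T z) + card (T' z)"
      using least[OF z(1) acc_trans[OF x y(2) z(2)] z(3)] .
    ultimately have "card (T z) = card (T y)" "card (T' z) = card (T' y)" by linarith+
    then show "T z = T y" "T' z = T' y"
      using T_mono[OF y(1) z(2)] T_fin by (simp_all add: card_subset_eq)
  qed
  have not_K: "\<not> K z'" if "mcs A z" "acc z z'" "\<not> K z" for z z'
    using types_mono[OF that(1,2)] that(3) unfolding K_def by blast

  have "\<forall>t\<in>T' y. \<exists>z. mcs A z \<and> acc y z \<and> \<not> K z \<and> z \<inter> \<Sigma> = t"
    unfolding T'_def by blast
  from bchoice[OF this]
  obtain Z where Z: "\<forall>t\<in>T' y. mcs A (Z t) \<and> acc y (Z t) \<and> \<not> K (Z t) \<and> Z t \<inter> \<Sigma> = t" ..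
  have "\<exists>M :: 'v fm set list set \<times> _ \<times> ('v \<Rightarrow> _). realizes \<Sigma> (types A \<Sigma> (Z t)) M"
    if t: "t \<in> T' y" for t
  proof (rule less.hyps)
    have "acc x (Z t)" using acc_trans[OF x y(2)] Z t by blast
    then have "types A \<Sigma> (Z t) \<subset> types A \<Sigma> x"
      using types_mono[OF x] Z t unfolding K_def by blast
    then show "card (types A \<Sigma> (Z t)) < card (types A \<Sigma> x)"
      by (rule psubset_card_mono[OF finite_types[OF \<Sigma>(1)]])
  qed (use Z t in blast)
  then have "\<forall>t\<in>T' y. \<exists>M :: 'v fm set list set \<times> _ \<times> ('v \<Rightarrow> _). realizes \<Sigma> (types A \<Sigma> (Z t)) M"
    by blast
  from bchoice[OF this] obtain M :: "'v fm set \<Rightarrow> 'v fm set list set \<times>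
      ('v fm set list \<times> 'v fm set list) set \<times> ('v \<Rightarrow> 'v fm set list set)"
    where M: "\<forall>t\<in>T' y. realizes \<Sigma> (types A \<Sigma> (Z t)) (M t)" ..
  define Wt where "Wt = (\<lambda>t. fst (M t))"
  define Rt where "Rt = (\<lambda>t. fst (snd (M t)))"
  define ht where "ht = (\<lambda>t. snd (snd (M t)))"
  have Mt: "finite (Wt t)" "[] \<notin> Wt t" "Rt t \<subseteq> Wt t \<times> Wt t" "refl_on (Wt t) (Rt t)" "trans (Rt t)"
      "(\<lambda>m. {\<chi> \<in> \<Sigma>. sat \<chi> (Wt t) (Rt t) (ht t) m}) ` Wt t = types A \<Sigma> (Z t)"
    if "t \<in> T' y" for t
    using M that unfolding realizes_def Wt_def Rt_def ht_def by (auto simp: split_beta)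

  define c where "c = (\<lambda>t :: 'v fm set. [t])"
  define Up where "Up = (\<Union>t\<in>T' y. (#) t ` Wt t)"
  define W where "W = c ` T y \<union> Up"
  \<comment> \<open>The cluster sees everything; the copy with prefix \<open>t\<close> keeps its own
    relation and sees nothing else.\<close>
  define R where "R = (c ` T y) \<times> W \<union> (\<Union>t\<in>T' y. {(t # a, t # b) | a b. (a, b) \<in> Rt t})"
  define h where "h = (\<lambda>p. c ` {t \<in> T y. Atom p \<in> t} \<union> (\<Union>t\<in>T' y. (#) t ` (ht t p \<inter> Wt t)))"
  have c_Up: "c t \<notin> Up" for t using Mt(2) unfolding c_def Up_def by auto
  have Up_iff: "t # m \<in> Up \<longleftrightarrow> t \<in> T' y \<and> m \<in> Wt t" for t m unfolding Up_def by auto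
  have R_sub: "R \<subseteq> W \<times> W"
    using Mt(3) unfolding R_def W_def Up_def by blast
  have R_Cons: "(t # a, w) \<in> R \<longleftrightarrow> (\<exists>b. w = t # b \<and> (a, b) \<in> Rt t)" if "t \<in> T' y" "a \<in> Wt t" for t a w
    using Mt(2)[OF that(1)] that unfolding R_def c_def by auto
  have R_c: "(c t, w) \<in> R \<longleftrightarrow> w \<in> W" if "t \<in> T y" for t w
    using that Mt(2,3) unfolding R_def c_def by blast
  have R_Up: "w \<in> Up" if vw: "(v, w) \<in> R" "v \<in> Up" for v w
  proof -
    obtain t a where ta: "t \<in> T' y" "a \<in> Wt t" "v = t # a" using vw(2) unfolding Up_def by blast
    obtain b where b: "w = t # b" "(a, b) \<in> Rt t"
      using vw(1) unfolding ta(3) R_Cons[OF ta(1,2)] by (elim exE conjE)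
    have "b \<in> Wt t" using b(2) Mt(3)[OF ta(1)] by blast
    then show ?thesis unfolding b(1) Up_iff using ta(1) by simp
  qed
  have sat_Cons: "sat \<chi> W R h (t # m) = sat \<chi> (Wt t) (Rt t) (ht t) m"
    if t: "t \<in> T' y" "m \<in> Wt t" and "is_fm \<chi>" for t m \<chi>
  proof (rule sat_p_morphism[where f = "(#) t", symmetric])
    show "t # v \<in> W" if "v \<in> Wt t" for v using that t(1) Up_iff unfolding W_def by blast
    show "(t # v, t # w) \<in> R" if "(v, w) \<in> Rt t" for v w
    proof -
      have "v \<in> Wt t" using Mt(3)[OF t(1)] that by blast
      then show ?thesis unfolding R_Cons[OF t(1) \<open>v \<in> Wt t\<close>] using that by simp
    qed
    show "\<exists>w. (v, w) \<in> Rt t \<and> t # w = w'" if "v \<in> Wt t" "(t # v, w') \<in> R" for v w'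
      using that(2) unfolding R_Cons[OF t(1) that(1)] by auto
    show "v \<in> ht t p \<longleftrightarrow> t # v \<in> h p" if "v \<in> Wt t" for p v
      using t(1) that Mt(2)[OF t(1)] unfolding h_def c_def by auto
  qed (use t Mt(3) R_sub \<open>is_fm \<chi>\<close> in blast)+
  have "(\<lambda>m. {\<chi> \<in> \<Sigma>. sat \<chi> W R h m}) ` Up = (\<Union>t\<in>T' y. types A \<Sigma> (Z t))"
  proof -
    have "{\<chi> \<in> \<Sigma>. sat \<chi> W R h (t # m)} = {\<chi> \<in> \<Sigma>. sat \<chi> (Wt t) (Rt t) (ht t) m}"
      if "t \<in> T' y" "m \<in> Wt t" for t m
      using sat_Cons[OF that] \<Sigma>(2) over_is_fm by blast
    then have "(\<lambda>m. {\<chi> \<in> \<Sigma>. sat \<chi> W R h m}) ` Up =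
        (\<Union>t\<in>T' y. (\<lambda>m. {\<chi> \<in> \<Sigma>. sat \<chi> (Wt t) (Rt t) (ht t) m}) ` Wt t)"
      unfolding Up_def image_UN image_image by (intro SUP_cong image_cong) simp_all
    then show ?thesis using Mt(6) by simp
  qed
  \<comment> \<open>Whatever \<open>Z t\<close> sees is also seen from \<open>y\<close> and is still
    outside \<open>K\<close>; conversely \<open>Z t\<close> sees its own type
    \<open>t\<close>.\<close>
  also have "\<dots> = T' y"
  proof
    show "(\<Union>t\<in>T' y. types A \<Sigma> (Z t)) \<subseteq> T' y"
    proof (rule UN_least)
      fix t assume t: "t \<in> T' y"
      show "types A \<Sigma> (Z t) \<subseteq> T' y"
      proof
        fix s assume "s \<in> types A \<Sigma> (Z t)"
        then obtain z where z: "mcs A z" "acc (Z t) z" "s = z \<inter> \<Sigma>" unfolding types_def by blast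
        moreover have "acc y z" using acc_trans[OF y(1)] Z t z(2) by blast
        moreover have "\<not> K z" using not_K Z t z(1,2) by blast
        ultimately show "s \<in> T' y" unfolding T'_def by blast
      qed
    qed
    show "T' y \<subseteq> (\<Union>t\<in>T' y. types A \<Sigma> (Z t))"
    proof
      fix t assume t: "t \<in> T' y"
      then have "acc (Z t) (Z t)" using Z acc_refl by blast
      then have "t \<in> types A \<Sigma> (Z t)" using Z t unfolding types_def by blast
      then show "t \<in> (\<Union>t\<in>T' y. types A \<Sigma> (Z t))" using t by blast
    qed
  qed
  finally have th_Up: "(\<lambda>m. {\<chi> \<in> \<Sigma>. sat \<chi> W R h m}) ` Up = T' y" .

  interpret cluster A \<Sigma> y K W R h c Up "T y" "T' y"
  proof
    show "definable A K" unfolding K_def by (rule definable_types_superset[OF \<Sigma>])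
    show "z \<inter> \<Sigma> \<in> T y" if "mcs A z" "acc y z" "K z" for z
      using that unfolding T_def by blast
    show "z \<inter> \<Sigma> \<in> T' y" if "mcs A z" "acc y z" "\<not> K z" for z
      using that unfolding T'_def by blast
    show "\<exists>z'. mcs A z' \<and> acc z z' \<and> K z' \<and> z' \<inter> \<Sigma> = t"
      if "mcs A z" "acc y z" "K z" "t \<in> T y" for z t
    proof -
      have "t \<in> T z" using final(1)[OF that(1-3)] that(4) by simp
      then show ?thesis unfolding T_def by auto
    qed
    show "\<exists>z'. mcs A z' \<and> acc z z' \<and> \<not> K z' \<and> z' \<inter> \<Sigma> = t"
      if "mcs A z" "acc y z" "K z" "t \<in> T' y" for z t
    proof -
      have "t \<in> T' z" using final(2)[OF that(1-3)] that(4) by simp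
      then show ?thesis unfolding T'_def by auto
    qed
    show "inj_on c (T y)" by (simp add: c_def inj_on_def)
    show "c ` T y \<inter> Up = {}" using c_Up by blast
    show "c t \<in> h p \<longleftrightarrow> Atom p \<in> t" if "t \<in> T y" for p t
      using that Mt(2) unfolding h_def c_def by auto
    show "\<not> K z'" if "mcs A z" "acc y z" "mcs A z'" "acc z z'" "\<not> K z" for z z'
      by (rule not_K[OF that(1,4,5)])
    show "w \<in> Up" if "(v, w) \<in> R" "v \<in> Up" for v w
      by (rule R_Up[OF that])
  qed (fact y(1) \<Sigma> R_sub R_c th_Up W_def)+

  have agree: "agree \<chi>" if \<chi>: "\<chi> \<in> \<Sigma>" for \<chi>
  proof (rule agree_closure[OF cl _ atoms])
    show "\<forall>p\<in>fv \<phi>. agree (Atom p)"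
    proof
      fix p assume "p \<in> fv \<phi>"
      then have "Atom p \<in> \<Sigma>" using fv_in_closure unfolding \<Sigma>_def by fast
      then show "agree (Atom p)"
        unfolding agree_def sat.simps(1) using h K_type by blast
    qed
  qed (use \<chi> \<Sigma>_def in simp_all)
  have "{\<chi> \<in> \<Sigma>. sat \<chi> W R h (c t)} = t" if t: "t \<in> T y" for t
  proof -
    obtain z where "mcs A z" "acc y z" "K z" "t = z \<inter> \<Sigma>" using t unfolding T_def by blast
    then show ?thesis using agree unfolding agree_def by blast
  qed
  then have "(\<lambda>m. {\<chi> \<in> \<Sigma>. sat \<chi> W R h m}) ` (c ` T y) = T y"
    unfolding image_image by simp
  moreover have "f ` W = f ` (c ` T y) \<union> f ` Up" for f :: "'v fm set list \<Rightarrow> 'v fm set"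
    unfolding W_def by (rule image_Un)
  ultimately have th: "(\<lambda>m. {\<chi> \<in> \<Sigma>. sat \<chi> W R h m}) ` W = types A \<Sigma> x"
    using th_Up types_y types_T[of y] by simp

  have "realizes \<Sigma> (types A \<Sigma> x) (W, R, h)"
    unfolding realizes_def prod.case
  proof (intro conjI R_sub th)
    show "finite W" using T_fin Mt(1) unfolding W_def Up_def by simp
    show "[] \<notin> W" unfolding W_def Up_def c_def by auto
    show "refl_on W R"
    proof (rule refl_onI)
      fix w assume "w \<in> W"
      then consider t where "t \<in> T y" "w = c t" | t a where "t \<in> T' y" "a \<in> Wt t" "w = t # a"
        unfolding W_def Up_def by blast
      then show "(w, w) \<in> R"
      proof cases
        case 1
        then show ?thesis using R_c \<open>w \<in> W\<close> by simp
      next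
        case 2
        show ?thesis unfolding 2(3) R_Cons[OF 2(1,2)] using refl_onD[OF Mt(4)[OF 2(1)] 2(2)] by simp
      qed
    qed
    show "trans R"
    proof (rule transI)
      fix u v w assume *: "(u, v) \<in> R" "(v, w) \<in> R"
      then have "u \<in> W" "w \<in> W" using R_sub by blast+
      then consider t where "t \<in> T y" "u = c t" | t a where "t \<in> T' y" "a \<in> Wt t" "u = t # a"
        unfolding W_def Up_def by blast
      then show "(u, w) \<in> R"
      proof cases
        case 1
        then show ?thesis using R_c \<open>w \<in> W\<close> by simp
      next
        case 2
        obtain b where b: "v = t # b" "(a, b) \<in> Rt t"
          using *(1) unfolding 2(3) R_Cons[OF 2(1,2)] by (elim exE conjE)
        have b': "b \<in> Wt t" using b(2) Mt(3)[OF 2(1)] by blast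
        obtain d where d: "w = t # d" "(b, d) \<in> Rt t"
          using *(2) unfolding b(1) R_Cons[OF 2(1) b'] by (elim exE conjE)
        show ?thesis
          unfolding 2(3) R_Cons[OF 2(1,2)] using d(1) transD[OF Mt(5)[OF 2(1)] b(2) d(2)] by simp
      qed
    qed
  qed
  then show ?case by blast
qed

section \<open>Transfer to a given infinite type of worlds\<close>

lemma valid_in_isomorphic:
  assumes inj: "inj_on f W" and R: "R \<subseteq> W \<times> W" and "is_fm \<phi>" "w \<in> W" "\<not> sat \<phi> W R h w"
  shows "\<not> valid_in (f ` W, map_prod f f ` R) \<phi>"
proof -
  let ?R = "map_prod f f ` R" and ?h = "\<lambda>p. f ` (h p \<inter> W)"
  have "sat \<phi> W R h w = sat \<phi> (f ` W) ?R ?h (f w)"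
  proof (rule sat_p_morphism[where f = f])
    show "\<exists>w. (v, w) \<in> R \<and> f w = w'" if v: "v \<in> W" "(f v, w') \<in> ?R" for v w'
    proof -
      obtain a b where ab: "(a, b) \<in> R" "f a = f v" "f b = w'" using v(2) by auto
      then have "a = v" using R v(1) inj by (auto dest: inj_onD)
      then show ?thesis using ab by blast
    qed
    show "v \<in> h p \<longleftrightarrow> f v \<in> f ` (h p \<inter> W)" if "v \<in> W" for p v
      using that inj by (auto dest: inj_onD)
  qed (use assms in auto)
  then have "\<not> sat \<phi> (f ` W) ?R ?h (f w)" using assms(5) by simp
  moreover have "sat \<phi> (f ` W) ?R ?h (f w)" if "valid_in (f ` W, ?R) \<phi>"
    using that[unfolded valid_in_def fst_conv snd_conv, rule_format, of ?h "f w"] assms(4) by blast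
  ultimately show ?thesis by blast
qed

lemma derivable_complete:
  fixes \<phi> :: "'v fm"
  assumes \<phi>: "over A \<phi>" and inf: "infinite (UNIV :: 'w set)"
    and valid: "\<forall>F\<in>finite_S4_frames :: 'w frame set. valid_in F \<phi>"
  shows "derivable \<phi>"
proof (rule iffD2[OF derivable_iff_mcs[OF \<phi>]], intro allI impI)
  fix x assume x: "mcs A x"
  let ?\<Sigma> = "closure Atom \<phi>"
  obtain W R and h :: "'v \<Rightarrow> 'v fm set list set"
    where M: "realizes ?\<Sigma> (types A ?\<Sigma> x) (W, R, h)"
    using ex_finite_model[OF \<phi> HOL.refl x] by (metis prod_cases3)
  then have fin: "finite W" and R: "R \<subseteq> W \<times> W" "refl_on W R" "trans R"
    and th: "(\<lambda>m. {\<chi> \<in> ?\<Sigma>. sat \<chi> W R h m}) ` W = types A ?\<Sigma> x"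
    unfolding realizes_def by simp_all
  have "x \<inter> ?\<Sigma> \<in> types A ?\<Sigma> x" using x acc_refl unfolding types_def by blast
  then obtain w where w: "w \<in> W" "x \<inter> ?\<Sigma> = {\<chi> \<in> ?\<Sigma>. sat \<chi> W R h w}"
    unfolding th[symmetric] by blast
  \<comment> \<open>The worlds are lists of sets of formulas so far; any \<open>B\<close> of the
    same size provides names for them in \<open>'w\<close>.\<close>
  obtain B :: "'w set" where "finite B" "card B = card W"
    using infinite_arbitrarily_large[OF inf] by blast
  then obtain f where f: "bij_betw f W B" using finite_same_card_bij[OF fin] by metis
  then have inj: "inj_on f W" by (rule bij_betw_imp_inj_on)
  have "(f ` W, map_prod f f ` R) \<in> finite_S4_frames"
    unfolding finite_S4_frames_def mem_Collect_eq prod.case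
  proof (intro conjI)
    show "finite (f ` W)" using fin by simp
    show "map_prod f f ` R \<subseteq> f ` W \<times> f ` W" using R(1) by auto
    show "refl_on (f ` W) (map_prod f f ` R)"
      using R(2) by (auto intro!: refl_onI dest: refl_onD)
    show "trans (map_prod f f ` R)"
    proof (rule transI)
      fix u v w assume "(u, v) \<in> map_prod f f ` R" "(v, w) \<in> map_prod f f ` R"
      then obtain a b b' d where *: "(a, b) \<in> R" "(b', d) \<in> R" "f b = f b'" "u = f a" "w = f d" "v = f b"
        by auto
      then have "b = b'" using R(1) inj by (auto dest: inj_onD)
      then have "(a, d) \<in> R" using * R(3) by (auto dest: transD)
      then show "(u, w) \<in> map_prod f f ` R" using * by auto
    qed
  qed
  then have "sat \<phi> W R h w"
    using valid valid_in_isomorphic[OF inj R(1) over_is_fm[OF \<phi>] w(1)] by blast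
  moreover have "\<phi> \<in> ?\<Sigma>" using ssubst_in_closure[of Atom \<phi>] by simp
  ultimately show "\<phi> \<in> x" using w(2) by blast
qed

theorem theorem3p7:
  assumes "infinite (UNIV :: 'v set)"
  shows "sound_over (S4mu :: 'v fm \<Rightarrow> bool) (finite_S4_frames :: 'w frame set) \<and>
    (infinite (UNIV :: 'w set) \<longrightarrow>
      complete_over (S4mu :: 'v fm \<Rightarrow> bool) (finite_S4_frames :: 'w frame set))"
proof (intro conjI impI S4mu_sound)
  assume inf: "infinite (UNIV :: 'w set)"
  have "S4mu \<phi>" if \<phi>: "is_fm \<phi>" and valid: "\<forall>F\<in>finite_S4_frames :: 'w frame set. valid_in F \<phi>"
    for \<phi> :: "'v fm"
  proof -
    \<comment> \<open>With \<open>A = fv \<phi>\<close> the renamed formula is over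
      \<open>A\<close>: its free atoms are those of \<open>\<phi>\<close>, and its bound atoms avoid
      them.\<close>
    obtain \<phi>' where \<phi>': "\<phi> =\<^sub>\<alpha> \<phi>'" "clean (fv \<phi>) \<phi>'" "fv \<phi>' = fv \<phi>"
      using ex_alpha_clean[OF assms finite_fv \<phi>] by blast
    have "valid_in F \<phi>'" if F: "F \<in> finite_S4_frames" for F :: "'w frame"
    proof -
      have "snd F \<subseteq> fst F \<times> fst F" using F unfolding finite_S4_frames_def by auto
      from alpha_eq_sat[OF this \<phi>'(1)] show ?thesis
        using valid F unfolding valid_in_def by blast
    qed
    moreover have "over (fv \<phi>) \<phi>'" using \<phi>'(2,3) by (simp add: over_def)
    ultimately have "derivable \<phi>'" using derivable_complete inf by blast
    then show ?thesis using \<phi>'(1) unfolding S4mu_def by blast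
  qed
  then show "complete_over (S4mu :: 'v fm \<Rightarrow> bool) (finite_S4_frames :: 'w frame set)"
    unfolding complete_over_def by blast
qed

end
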